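(* Let $G$ be a finite group. The following conditions are equivalent. (1) $G$ is an IYB group, that is, for some positive integer $n$ there is a map $\phi:\mathrm{Fa}_n\to \mathrm{Sym}_n$ such that $\{(a,\phi(a)) : a\in \mathrm{Fa}_n\}$ is a subgroup of $\mathrm{Fa}_n\rtimes \mathrm{Sym}_n$ and $G$ is isomorphic to $\phi(\mathrm{Fa}_n)$. (2) There are an abelian group $A$, an action of $G$ on $A$ and a group homomorphism $\rho:G\to A\rtimes G$ such that $\pi_G\rho=\mathrm{id}_G$ and $\pi_A\rho:G\to A$ is bijective, where $\pi_G: A\rtimes G\to G$ and $\pi_A: A\rtimes G\to A$ are the natural projections. (3) There are an abelian group $A$, an action of $G$ on $A$ and a bijective 1-cocycle $G\to A$. (4) There exist finite sets $A$ and $X$ and an IYB map $\lambda: A\cup X\to \mathrm{Sym}_{A\cup X}$ satisfying: (a) $\lambda(A)$ is a subgroup of $\mathrm{Sym}_{A\cup X}$ isomorphic to $G$; (b) $A\cap X=\emptyset$; (c) $\lambda(x)=\mathrm{id}_{A\cup X}$ for all $x\in X$; (d) $\lambda(a)(b)\in A$ for all $a,b\in A$; (e) the restriction $\lambda|_A$ is injective. (5) $G\cong\lambda(X)$ for some finite set $X$ and some IYB map $\lambda:X\to \mathrm{Sym}_X$ whose image is a subgroup of $\mathrm{Sym}_X$. (6) $G\cong\langle\lambda(X)\rangle$ for some finite set $X$ and some IYB map $\lambda:X\to \mathrm{Sym}_X$. (7) There exists a group homomorphism $\mu:G\to \mathrm{Sym}_G$ satisfying $x\,\mu(x)^{-1}(y)=y\,\mu(y)^{-1}(x)$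 for all $x,y\in G$. (8) There exist a generating subset $Z$ of $G$ and a group homomorphism $\mu:G\to \mathrm{Sym}_Z$ satisfying $x\,\mu(x)^{-1}(y)=y\,\mu(y)^{-1}(x)$ (products taken in $G$) for all $x,y\in Z$.
   Context: For a set $X$, $\mathrm{Sym}_X$ denotes the group of all permutations of $X$; $\mathrm{Sym}_n$ is the symmetric group of degree $n$. $\mathrm{Fa}_n$ is the free abelian group (written multiplicatively) with basis $u_1,\dots,u_n$, and $\mathrm{Fa}_n\rtimes \mathrm{Sym}_n$ is the semidirect product for the natural action $\sigma(u_i)=u_{\sigma(i)}$, i.e. $(a,\sigma)(b,\tau)=(a\,\sigma(b),\sigma\tau)$. An involutive Yang-Baxter map (IYB map) on a finite set $X$ is a map $\lambda:X\to \mathrm{Sym}_X$ such that $\lambda(x)\,\lambda(\lambda(x)^{-1}(y))=\lambda(y)\,\lambda(\lambda(y)^{-1}(x))$ for all $x,y\in X$. All actions of a group $G$ on an abelian group $A$ are by automorphisms of $A$. Abelian groups are written multiplicatively. A (bijective) 1-cocycle $\pi:G\to A$ with respect to such an action is a (bijective) map with $\pi(gh)=\pi(g)\,g(\pi(h))$ for all $g,h\in G$. *)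

theory Defs
  imports "HOL-Algebra.Bij" "HOL-Algebra.Generated_Groups" "HOL-Algebra.Sym_Groups"
    "HOL-Algebra.Free_Abelian_Groups" "HOL-Library.Infinite_Typeclass"
begin

text \<open>
  Conventions. \<open>Sym\<^sub>X\<close> is \<^const>\<open>BijGroup\<close>, whose elements are the bijections of \<open>X\<close> that are
  extensional (undefined outside \<open>X\<close>); its product is composition, the right factor being applied
  first. \<open>Sym\<^sub>n\<close> is \<^const>\<open>sym_group\<close> and \<open>Fa\<^sub>n\<close> is \<open>free_Abelian_group {1..n}\<close>, with basis
  \<open>u\<^sub>i = frag_of i\<close>; the product of the latter is the sum of finitely supported functions.
  An action of \<open>G\<close> on \<open>A\<close> by automorphisms is an element of \<open>hom G (AutoGroup A)\<close>.

  HOL has no quantification over types. An existential statement about an abelian group or a finite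
  set is therefore made over an arbitrary type of sort \<open>infinite\<close>, a separate type variable for each
  such statement: the sort guarantees room for every finite set, and being universally
  quantified the type places no restriction on the kind of elements.
\<close>

definition semidirect_product ::
    "('a, 'm) monoid_scheme \<Rightarrow> ('g, 'k) monoid_scheme \<Rightarrow> ('g \<Rightarrow> 'a \<Rightarrow> 'a) \<Rightarrow> ('a \<times> 'g) monoid"
  where "semidirect_product A G \<alpha> =
    \<lparr>carrier = carrier A \<times> carrier G,
     monoid.mult = (\<lambda>(a, g) (b, h). (a \<otimes>\<^bsub>A\<^esub> \<alpha> g b, g \<otimes>\<^bsub>G\<^esub> h)),
     one = (\<one>\<^bsub>A\<^esub>, \<one>\<^bsub>G\<^esub>)\<rparr>"

definition one_cocycle ::
    "('g, 'k) monoid_scheme \<Rightarrow> ('a, 'm) monoid_scheme \<Rightarrow> ('g \<Rightarrow> 'a \<Rightarrow> 'a) \<Rightarrow> ('g \<Rightarrow> 'a) \<Rightarrow> bool"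
  where "one_cocycle G A \<alpha> \<pi> \<longleftrightarrow>
    \<pi> \<in> carrier G \<rightarrow> carrier A \<and>
    (\<forall>g\<in>carrier G. \<forall>h\<in>carrier G. \<pi> (g \<otimes>\<^bsub>G\<^esub> h) = \<pi> g \<otimes>\<^bsub>A\<^esub> \<alpha> g (\<pi> h))"

text \<open>The homomorphism of \<open>Fa\<^sub>n\<close> determined by \<open>\<sigma>(u\<^sub>i) = u\<^bsub>\<sigma>(i)\<^esub>\<close>.\<close>

definition natural_action :: "nat \<Rightarrow> (nat \<Rightarrow> nat) \<Rightarrow> (nat \<Rightarrow>\<^sub>0 int) \<Rightarrow> (nat \<Rightarrow>\<^sub>0 int)"
  where "natural_action n \<sigma> =
    (\<lambda>a\<in>carrier (free_Abelian_group {1..n}). frag_extend (\<lambda>i. frag_of (\<sigma> i)) a)"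

definition Fa_Sym :: "nat \<Rightarrow> ((nat \<Rightarrow>\<^sub>0 int) \<times> (nat \<Rightarrow> nat)) monoid"
  where "Fa_Sym n =
    semidirect_product (free_Abelian_group {1..n}) (sym_group n) (natural_action n)"

definition IYB_group :: "('g, 'k) monoid_scheme \<Rightarrow> bool"
  where "IYB_group G \<longleftrightarrow>
    (\<exists>n>0. \<exists>\<phi> \<in> carrier (free_Abelian_group {1..n}) \<rightarrow> carrier (sym_group n).
       subgroup {(a, \<phi> a) |a. a \<in> carrier (free_Abelian_group {1..n})} (Fa_Sym n) \<and>
       G \<cong> (sym_group n)\<lparr>carrier := \<phi> ` carrier (free_Abelian_group {1..n})\<rparr>)"

definition IYB_map :: "'x set \<Rightarrow> ('x \<Rightarrow> 'x \<Rightarrow> 'x) \<Rightarrow> bool"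
  where "IYB_map X \<Lambda> \<longleftrightarrow>
    finite X \<and> \<Lambda> \<in> X \<rightarrow> carrier (BijGroup X) \<and>
    (\<forall>x\<in>X. \<forall>y\<in>X.
       \<Lambda> x \<otimes>\<^bsub>BijGroup X\<^esub> \<Lambda> ((inv\<^bsub>BijGroup X\<^esub> (\<Lambda> x)) y) =
       \<Lambda> y \<otimes>\<^bsub>BijGroup X\<^esub> \<Lambda> ((inv\<^bsub>BijGroup X\<^esub> (\<Lambda> y)) x))"

lemma AutoGroup_hom_simps:
  assumes "\<alpha> \<in> hom G (AutoGroup A)" "g \<in> carrier G" "h \<in> carrier G"
    and "a \<in> carrier A" "b \<in> carrier A"
  shows "\<alpha> g a \<in> carrier A"
    and "\<alpha> g (a \<otimes>\<^bsub>A\<^esub> b) = \<alpha> g a \<otimes>\<^bsub>A\<^esub> \<alpha> g b"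
    and "\<alpha> (g \<otimes>\<^bsub>G\<^esub> h) a = \<alpha> g (\<alpha> h a)"
proof -
  have g: "\<alpha> g \<in> auto A" and h: "\<alpha> h \<in> auto A"
    using assms(1-3) by (auto simp: hom_def AutoGroup_def)
  show "\<alpha> g a \<in> carrier A" "\<alpha> g (a \<otimes>\<^bsub>A\<^esub> b) = \<alpha> g a \<otimes>\<^bsub>A\<^esub> \<alpha> g b"
    using g assms(4,5) by (auto simp: auto_def hom_def)
  have "\<alpha> (g \<otimes>\<^bsub>G\<^esub> h) = \<alpha> g \<otimes>\<^bsub>AutoGroup A\<^esub> \<alpha> h"
    using assms(1-3) by (simp add: hom_mult)
  also have "\<dots> = compose (carrier A) (\<alpha> g) (\<alpha> h)"
    using g h by (simp add: AutoGroup_def BijGroup_def auto_def)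
  finally show "\<alpha> (g \<otimes>\<^bsub>G\<^esub> h) a = \<alpha> g (\<alpha> h a)"
    using assms(4) by (simp add: compose_def)
qed

lemma group_semidirect_product:
  assumes A: "group A" and G: "group G" and \<alpha>: "\<alpha> \<in> hom G (AutoGroup A)"
  shows "group (semidirect_product A G \<alpha>)"
proof -
  interpret A: group A by fact
  interpret G: group G by fact
  note s = AutoGroup_hom_simps[OF \<alpha>]
  have one: "\<alpha> \<one>\<^bsub>G\<^esub> a = a" if "a \<in> carrier A" for a
  proof -
    have "\<alpha> \<one>\<^bsub>G\<^esub> = \<one>\<^bsub>AutoGroup A\<^esub>"
      using hom_one[OF \<alpha> G A.AutoGroup] .
    then show ?thesis using that by (simp add: AutoGroup_def BijGroup_def)
  qed
  show ?thesis
  proof (rule groupI; (clarsimp simp: semidirect_product_def)?)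
    fix a g assume ag: "a \<in> carrier A" "g \<in> carrier G"
    show "\<one>\<^bsub>A\<^esub> \<otimes>\<^bsub>A\<^esub> \<alpha> \<one>\<^bsub>G\<^esub> a = a"
      using ag one by simp
    show "\<exists>b\<in>carrier A. \<exists>h\<in>carrier G. b \<otimes>\<^bsub>A\<^esub> \<alpha> h a = \<one>\<^bsub>A\<^esub> \<and> h \<otimes>\<^bsub>G\<^esub> g = \<one>\<^bsub>G\<^esub>"
      using ag s(1)[of "inv\<^bsub>G\<^esub> g" "inv\<^bsub>G\<^esub> g" a a]
      by (intro bexI[of _ "inv\<^bsub>A\<^esub> (\<alpha> (inv\<^bsub>G\<^esub> g) a)"] bexI[of _ "inv\<^bsub>G\<^esub> g"]) auto
  next
    fix a g b h c k
    assume "a \<in> carrier A" "g \<in> carrier G" "b \<in> carrier A" "h \<in> carrier G"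
      "c \<in> carrier A" "k \<in> carrier G"
    then show "a \<otimes>\<^bsub>A\<^esub> \<alpha> g b \<otimes>\<^bsub>A\<^esub> \<alpha> (g \<otimes>\<^bsub>G\<^esub> h) c = a \<otimes>\<^bsub>A\<^esub> \<alpha> g (b \<otimes>\<^bsub>A\<^esub> \<alpha> h c) \<and>
        g \<otimes>\<^bsub>G\<^esub> h \<otimes>\<^bsub>G\<^esub> k = g \<otimes>\<^bsub>G\<^esub> (h \<otimes>\<^bsub>G\<^esub> k)"
      using s by (simp add: A.m_assoc G.m_assoc)
  qed (use s in auto)
qed

lemma natural_action_in_hom:
  "natural_action n \<in> hom (sym_group n) (AutoGroup (free_Abelian_group {1..n}))"
proof -
  let ?F = "free_Abelian_group {1..n}"
  let ?e = "\<lambda>\<sigma>. frag_extend (\<lambda>i. frag_of (\<sigma> i))"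
  have closed: "?e \<sigma> a \<in> carrier ?F" if "\<sigma> permutes {1..n}" "a \<in> carrier ?F" for \<sigma> a
  proof -
    have "Poly_Mapping.keys (?e \<sigma> a) \<subseteq> \<sigma> ` Poly_Mapping.keys a"
      using keys_frag_extend[of "\<lambda>i. frag_of (\<sigma> i)" a] by auto
    also have "\<dots> \<subseteq> {1..n}"
      using that permutes_image[of \<sigma> "{1..n}"] by auto
    finally show ?thesis by simp
  qed
  have comp: "?e \<sigma> (?e \<tau> a) = ?e (\<sigma> \<circ> \<tau>) a" for \<sigma> \<tau> :: "nat \<Rightarrow> nat" and a
    using frag_extend_compose[of "\<lambda>i. frag_of (\<sigma> i)" \<tau> a] by (simp add: o_def)
  have ident: "?e id a = a" for a :: "nat \<Rightarrow>\<^sub>0 int"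
    using frag_expansion[of a] by (simp add: o_def)
  have aut: "natural_action n \<sigma> \<in> auto ?F" if "\<sigma> permutes {1..n}" for \<sigma>
  proof -
    have inv: "?e (inv' \<sigma>) (?e \<sigma> a) = a" "?e \<sigma> (?e (inv' \<sigma>) a) = a" for a
      using that ident by (simp_all add: comp permutes_inv_o)
    have "bij_betw (?e \<sigma>) (carrier ?F) (carrier ?F)"
      by (rule bij_betw_byWitness[where f' = "?e (inv' \<sigma>)"])
        (use closed[OF that] closed[OF permutes_inv[OF that]] inv in blast)+
    then have "natural_action n \<sigma> \<in> Bij (carrier ?F)"
      unfolding Bij_def natural_action_def
      by (simp add: bij_betw_restrict_eq del: carrier_free_Abelian_group_iff)
    moreover have "natural_action n \<sigma> \<in> hom ?F ?F"
    proof (rule homI)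
      fix a b assume ab: "a \<in> carrier ?F" "b \<in> carrier ?F"
      show "natural_action n \<sigma> a \<in> carrier ?F"
        using ab closed[OF that] unfolding natural_action_def by (simp del: carrier_free_Abelian_group_iff)
      have "a + b \<in> carrier ?F"
        using ab monoid.m_closed[OF group.is_monoid[OF group_free_Abelian_group]]
        by (metis mult_free_Abelian_group)
      with ab show "natural_action n \<sigma> (a \<otimes>\<^bsub>?F\<^esub> b) =
          natural_action n \<sigma> a \<otimes>\<^bsub>?F\<^esub> natural_action n \<sigma> b"
        unfolding natural_action_def
        by (simp add: frag_extend_add del: carrier_free_Abelian_group_iff)
    qed
    ultimately show ?thesis by (simp add: auto_def)
  qed
  show ?thesis
  proof (rule homI)
    fix \<sigma> \<tau> assume "\<sigma> \<in> carrier (sym_group n)" "\<tau> \<in> carrier (sym_group n)"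
    then have p: "\<sigma> permutes {1..n}" "\<tau> permutes {1..n}"
      by (simp_all add: sym_group_carrier)
    show "natural_action n \<sigma> \<in> carrier (AutoGroup ?F)"
      using aut[OF p(1)] by (simp add: AutoGroup_def)
    have "natural_action n \<sigma> \<otimes>\<^bsub>AutoGroup ?F\<^esub> natural_action n \<tau> =
        compose (carrier ?F) (natural_action n \<sigma>) (natural_action n \<tau>)"
      using aut[OF p(1)] aut[OF p(2)] by (simp add: AutoGroup_def BijGroup_def auto_def)
    also have "\<dots> = natural_action n (\<sigma> \<circ> \<tau>)"
      using closed[OF p(2)]
      by (auto simp: natural_action_def compose_def comp fun_eq_iff
          simp del: carrier_free_Abelian_group_iff)
    finally show "natural_action n (\<sigma> \<otimes>\<^bsub>sym_group n\<^esub> \<tau>) =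
        natural_action n \<sigma> \<otimes>\<^bsub>AutoGroup ?F\<^esub> natural_action n \<tau>"
      by (simp add: sym_group_mult)
  qed
qed

lemma group_Fa_Sym: "group (Fa_Sym n)"
  unfolding Fa_Sym_def
  by (intro group_semidirect_product group_free_Abelian_group sym_group_is_group
      natural_action_in_hom)

end

theory Submission
  imports Defs "HOL-Algebra.Group_Action"
begin

text \<open>
  All conditions are compared with the existence of a \<^emph>\<open>brace\<close> on \<open>G\<close>: an action \<open>\<mu>\<close> of \<open>G\<close> on
  its own underlying set such that \<open>x + y = x \<mu>(x)\<^sup>-\<^sup>1(y)\<close> is commutative. The brace lives on \<open>G\<close>
  itself and refers to no auxiliary set or group, so that it can mediate between conditions whose
  witnesses live in unrelated types.

  Towards a brace, the other conditions lead to a set \<open>X\<close> on which \<open>G\<close> acts, with labels in \<open>G\<close> that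
  generate \<open>G\<close> and satisfy \<open>l(x) l(l(x)\<^sup>-\<^sup>1 y) = l(y) l(l(y)\<^sup>-\<^sup>1 x)\<close> (locale \<open>iyb_labelling\<close>). Each \<open>x\<close>
  then defines a self-map \<open>R\<^sub>x(g) = g l(g\<^sup>-\<^sup>1 x)\<close> of \<open>G\<close>. These maps commute, they reach all of \<open>G\<close> from
  \<open>\<one>\<close> because \<open>G\<close> is finite and generated by the labels, and \<open>L\<^sub>g R\<^sub>x = R\<^bsub>g x\<^esub> L\<^sub>g\<close> for the left
  translations \<open>L\<^sub>g\<close>. A commutative monoid that is transitive from one point is regular, so the monoid
  \<open>M\<close> generated by the \<open>R\<^sub>x\<close> is identified with \<open>G\<close>, and the conjugation action of \<open>G\<close> on \<open>M\<close> becomes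
  the required \<open>\<mu>\<close> (lemma \<open>exists_brace\<close>).

  In the other direction, commutativity of \<open>+\<close> alone forces \<open>(G, +)\<close> to be an abelian group on which
  \<open>G\<close> acts through \<open>\<mu>\<close> by automorphisms, and the defining formula reads \<open>x y = x + \<mu>(x)(y)\<close>: the
  identity map is a bijective cocycle. Since \<open>\<mu>\<close> need not be faithful, the IYB maps and the map
  \<open>\<phi> : Fa\<^sub>n \<rightarrow> Sym\<^sub>n\<close> are built on two copies of \<open>G\<close>, with \<open>\<mu>\<close> on the first and left translation on
  the second (lemma \<open>faithful_labelled_action\<close>).
\<close>

section \<open>Group actions\<close>

text \<open>
  The library expresses an action as a homomorphism into the group of extensional bijections. This
  is the convenient way in from a plain action, which has to be cut down to \<open>E\<close>.
\<close>
lemma group_actionI: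
  assumes "group G"
    and closed: "\<And>g x. \<lbrakk>g \<in> carrier G; x \<in> E\<rbrakk> \<Longrightarrow> act g x \<in> E"
    and one: "\<And>x. x \<in> E \<Longrightarrow> act \<one>\<^bsub>G\<^esub> x = x"
    and mult: "\<And>g h x. \<lbrakk>g \<in> carrier G; h \<in> carrier G; x \<in> E\<rbrakk> \<Longrightarrow>
      act (g \<otimes>\<^bsub>G\<^esub> h) x = act g (act h x)"
  shows "group_action G E (\<lambda>g. restrict (act g) E)"
proof -
  interpret group G by fact
  have bij: "restrict (act g) E \<in> Bij E" if g: "g \<in> carrier G" for g
  proof -
    have "act (inv\<^bsub>G\<^esub> g) (act g x) = x" "act g (act (inv\<^bsub>G\<^esub> g) x) = x" if "x \<in> E" for x
      using that g one mult[of "inv\<^bsub>G\<^esub> g" g x] mult[of g "inv\<^bsub>G\<^esub> g" x] by simp_all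
    then have "bij_betw (act g) E E"
      using g closed by (intro bij_betw_byWitness[where f' = "act (inv\<^bsub>G\<^esub> g)"]) auto
    then show ?thesis
      by (simp add: Bij_def bij_betw_restrict_eq)
  qed
  have "(\<lambda>g. restrict (act g) E) \<in> hom G (BijGroup E)"
  proof (rule homI)
    fix g h assume gh: "g \<in> carrier G" "h \<in> carrier G"
    show "restrict (act g) E \<in> carrier (BijGroup E)"
      using bij gh by (simp add: BijGroup_def)
    show "restrict (act (g \<otimes>\<^bsub>G\<^esub> h)) E = restrict (act g) E \<otimes>\<^bsub>BijGroup E\<^esub> restrict (act h) E"
      using gh bij closed mult by (auto simp: BijGroup_def compose_def fun_eq_iff)
  qed
  then show ?thesis
    using assms(1) by (simp add: group_action_def group_hom_def group_hom_axioms_def group_BijGroup)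
qed

lemma group_action_iff_hom: "group G \<Longrightarrow> group_action G E \<phi> \<longleftrightarrow> \<phi> \<in> hom G (BijGroup E)"
  by (auto simp: group_action_def group_hom_def group_hom_axioms_def group_BijGroup)

lemma hom_AutoGroup_imp_group_action:
  assumes "group G" "\<alpha> \<in> hom G (AutoGroup A)"
  shows "group_action G (carrier A) \<alpha>"
proof -
  have "\<alpha> \<in> hom G (BijGroup (carrier A))"
    using assms(2) by (auto simp: hom_def AutoGroup_def auto_def BijGroup_def)
  then show ?thesis
    using assms(1) by (simp add: group_action_iff_hom)
qed

context group_action
begin

lemma group_G: "group G"
  using group_hom by (rule group_hom.axioms)

lemma action_closed [simp]: "\<lbrakk>g \<in> carrier G; x \<in> E\<rbrakk> \<Longrightarrow> \<phi> g x \<in> E"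
  using element_image by blast

lemma action_one [simp]: "x \<in> E \<Longrightarrow> \<phi> \<one> x = x"
  by (metis id_eq_one restrict_apply')

lemma action_inv [simp]:
  assumes "g \<in> carrier G" "x \<in> E"
  shows "\<phi> (inv g) (\<phi> g x) = x" "\<phi> g (\<phi> (inv g) x) = x"
  using assms composition_rule[of x g "inv g"] composition_rule[of x "inv g" g] group_G
  by (simp_all add: group.r_inv group.l_inv group.inv_closed)

lemma action_in_BijGroup: "g \<in> carrier G \<Longrightarrow> \<phi> g \<in> carrier (BijGroup E)"
  using bij_prop0 by (simp add: BijGroup_def)

lemma action_mult:
  "\<lbrakk>g \<in> carrier G; h \<in> carrier G\<rbrakk> \<Longrightarrow> \<phi> (g \<otimes> h) = \<phi> g \<otimes>\<^bsub>BijGroup E\<^esub> \<phi> h"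
  by (rule group_hom.hom_mult[OF group_hom])

lemma inv_BijGroup_action:
  "g \<in> carrier G \<Longrightarrow> inv\<^bsub>BijGroup E\<^esub> (\<phi> g) = \<phi> (inv g)"
  by (simp add: group_hom.hom_inv[OF group_hom])

definition transport
  where "transport e g = (\<lambda>y\<in>e ` E. e (\<phi> g (inv_into E e y)))"

lemma transport_apply:
  "\<lbrakk>inj_on e E; x \<in> E\<rbrakk> \<Longrightarrow> transport e g (e x) = e (\<phi> g x)"
  by (simp add: transport_def)

lemma group_action_transport:
  assumes "inj_on e E"
  shows "group_action G (e ` E) (transport e)"
  unfolding transport_def
  by (rule group_actionI[OF group_G]) (auto simp: assms composition_rule)

lemma inj_on_transport:
  assumes e: "inj_on e E" and "inj_on \<phi> (carrier G)"
  shows "inj_on (transport e) (carrier G)"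
proof (rule inj_onI)
  fix g h assume gh: "g \<in> carrier G" "h \<in> carrier G" "transport e g = transport e h"
  have "\<phi> g x = \<phi> h x" if "x \<in> E" for x
    using that gh transport_apply[OF e that, of g] transport_apply[OF e that, of h]
      inj_onD[OF e, of "\<phi> g x" "\<phi> h x"] by simp
  then have "\<phi> g = \<phi> h"
    using gh bij_prop0 by (intro extensionalityI[of _ E]) (auto simp: Bij_def)
  then show "g = h"
    using gh assms(2) by (simp add: inj_on_eq_iff)
qed

end

lemma (in group) hom_sym_group:
  assumes "group_action G {1..n} \<phi>"
  shows "(\<lambda>g i. if i \<in> {1..n} then \<phi> g i else i) \<in> hom G (sym_group n)"
proof -
  interpret group_action G "{1..n}" \<phi> by fact
  show ?thesis
  proof (rule homI)
    fix g h assume gh: "g \<in> carrier G" "h \<in> carrier G"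
    have "bij_betw (\<lambda>i. if i \<in> {1..n} then \<phi> g i else i) {1..n} {1..n}"
    proof (subst bij_betw_cong)
      show "bij_betw (\<phi> g) {1..n} {1..n}"
        using bij_prop0[OF gh(1)] unfolding Bij_def by blast
    qed simp
    then show "(\<lambda>i. if i \<in> {1..n} then \<phi> g i else i) \<in> carrier (sym_group n)"
      unfolding sym_group_carrier by (rule bij_imp_permutes) auto
    have "\<phi> h i \<in> {1..n}" if "i \<in> {1..n}" for i
      using action_closed[OF gh(2) that] .
    then show "(\<lambda>i. if i \<in> {1..n} then \<phi> (g \<otimes> h) i else i) =
        (\<lambda>i. if i \<in> {1..n} then \<phi> g i else i) \<otimes>\<^bsub>sym_group n\<^esub>
        (\<lambda>i. if i \<in> {1..n} then \<phi> h i else i)"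
      using gh by (auto simp: sym_group_mult fun_eq_iff composition_rule)
  qed
qed

section \<open>From a labelled action to a brace\<close>

text \<open>
  The common source of braces. In the semidirect product of the free abelian group on \<open>X\<close> with \<open>G\<close>
  write \<open>p\<^sub>x\<close> for \<open>(x, lab x)\<close>, and let \<open>y' = lab(x)\<^sup>-\<^sup>1 y\<close> and \<open>x' = lab(y)\<^sup>-\<^sup>1 x\<close>. The products
  \<open>p\<^sub>x p\<^bsub>y'\<^esub>\<close> and \<open>p\<^sub>y p\<^bsub>x'\<^esub>\<close> both have first component \<open>x + y\<close>, and the last assumption says that
  they are equal, as they must be if a subgroup that is the graph of a function contains all \<open>p\<^sub>x\<close>.

  An IYB map is the case in which the group lies in \<open>Sym\<^sub>X\<close>; the inverse of a bijective cocycle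
  labels the points of \<open>A\<close>; a generating subset of the group labels itself. The set \<open>X\<close> may be
  infinite, which lets \<open>Fa\<^sub>n\<close> itself be labelled.
\<close>
locale iyb_labelling = group_action G X act
  for G (structure) and X :: "'x set" and act +
  fixes lab :: "'x \<Rightarrow> 'a"
  assumes finite_G: "finite (carrier G)"
    and lab_closed: "lab \<in> X \<rightarrow> carrier G"
    and lab_generates: "generate G (lab ` X) = carrier G"
    and lab_commute: "\<lbrakk>x \<in> X; y \<in> X\<rbrakk> \<Longrightarrow>
      lab x \<otimes> lab (act (inv (lab x)) y) = lab y \<otimes> lab (act (inv (lab y)) x)"

text \<open>
  The condition on \<open>\<mu>\<close> says that \<open>(x, y) \<mapsto> x \<mu>(x)\<^sup>-\<^sup>1(y)\<close> is commutative. This operation will turn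
  out to be an abelian group law, for which \<open>G\<close> is the circle group of a left brace and \<open>\<mu>\<close> its
  lambda map.
\<close>
locale brace = group_action G "carrier G" \<mu> for G (structure) and \<mu> +
  assumes brace_commute: "\<lbrakk>x \<in> carrier G; y \<in> carrier G\<rbrakk> \<Longrightarrow>
      x \<otimes> \<mu> (inv x) y = y \<otimes> \<mu> (inv y) x"

context iyb_labelling
begin

sublocale group G
  by (rule group_G)

text \<open>
  Each point \<open>x\<close> defines a self-map of \<open>G\<close>, multiplication on the right by the label of \<open>x\<close> as seen
  from \<open>g\<close>. The symmetric law for the labels makes these maps commute, and conjugation by a left
  translation permutes them in the way in which \<open>G\<close> acts on \<open>X\<close>. The monoid that they generate
  is the future abelian group; a word in \<open>X\<close> stands for an element of it.
\<close>
definition step :: "'x \<Rightarrow> 'a \<Rightarrow> 'a"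
  where "step x g = g \<otimes> lab (act (inv g) x)"

abbreviation run :: "'x list \<Rightarrow> 'a \<Rightarrow> 'a"
  where "run \<equiv> fold step"

lemma lab_in [simp]: "x \<in> X \<Longrightarrow> lab x \<in> carrier G"
  using lab_closed by blast

lemma step_closed [simp]: "\<lbrakk>x \<in> X; g \<in> carrier G\<rbrakk> \<Longrightarrow> step x g \<in> carrier G"
  by (simp add: step_def)

lemma run_closed [simp]: "\<lbrakk>w \<in> lists X; g \<in> carrier G\<rbrakk> \<Longrightarrow> run w g \<in> carrier G"
  by (induction w arbitrary: g) auto

lemma step_commute:
  assumes "x \<in> X" "y \<in> X" "g \<in> carrier G"
  shows "step x (step y g) = step y (step x g)"
proof -
  have "step z (step z' g) =
      g \<otimes> (lab (act (inv g) z') \<otimes> lab (act (inv (lab (act (inv g) z'))) (act (inv g) z)))"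
    if "z \<in> X" "z' \<in> X" for z z'
    using that assms(3) by (simp add: step_def m_assoc inv_mult_group composition_rule)
  then show ?thesis
    using assms lab_commute[of "act (inv g) x" "act (inv g) y"] by simp
qed

lemma step_run: "\<lbrakk>x \<in> X; w \<in> lists X; g \<in> carrier G\<rbrakk> \<Longrightarrow> step x (run w g) = run w (step x g)"
  by (induction w arbitrary: g) (auto simp: step_commute)

lemma run_commute:
  "\<lbrakk>v \<in> lists X; w \<in> lists X; g \<in> carrier G\<rbrakk> \<Longrightarrow> run v (run w g) = run w (run v g)"
  by (induction v arbitrary: g) (auto simp: step_run)

lemma run_translate:
  "\<lbrakk>w \<in> lists X; g \<in> carrier G; h \<in> carrier G\<rbrakk> \<Longrightarrow>
    run (map (act g) w) (g \<otimes> h) = g \<otimes> run w h"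
proof (induction w arbitrary: h)
  case (Cons x w)
  have "step (act g x) (g \<otimes> h) = g \<otimes> step x h"
    using Cons.prems by (simp add: step_def inv_mult_group composition_rule m_assoc)
  then show ?case
    using Cons by simp
qed simp

text \<open>
  The set reached from \<open>\<one>\<close> is closed under right multiplication by labels, because the step along
  \<open>act h x\<close> multiplies \<open>h\<close> by the label of \<open>x\<close>. As the set is finite, right multiplication by a label
  permutes it, so that it is closed under the inverses of labels as well.
\<close>
lemma run_reaches:
  assumes "g \<in> carrier G"
  obtains w where "w \<in> lists X" "run w \<one> = g"
proof -
  define R where "R = (\<lambda>w. run w \<one>) ` lists X"
  have R_closed: "R \<subseteq> carrier G"
    unfolding R_def using run_closed[OF _ one_closed] by blast
  have one: "\<one> \<in> R"
    unfolding R_def by (rule image_eqI[of _ _ "[]"]) auto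
  have step_R: "step x h \<in> R" if "x \<in> X" "h \<in> R" for x h
  proof -
    from that(2) obtain w where w: "w \<in> lists X" "h = run w \<one>"
      by (auto simp: R_def)
    then have "step x h = run (w @ [x]) \<one>" "w @ [x] \<in> lists X"
      using that(1) by simp_all
    then show ?thesis
      unfolding R_def by blast
  qed
  have lab_R: "h \<otimes> lab x \<in> R" if "x \<in> X" "h \<in> R" for x h
    using step_R[of "act h x" h] that R_closed by (auto simp: step_def subset_iff)
  \<comment> \<open>The case \<open>h = \<one>\<close> suffices, but induction on \<open>g\<close> needs all \<open>h\<close>.\<close>
  have "\<forall>h\<in>R. h \<otimes> g \<in> R"
    using assms unfolding lab_generates[symmetric]
  proof (induction rule: generate.induct)
    case one
    then show ?case using R_closed by auto
  next
    case (incl k)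
    then show ?case using lab_R by auto
  next
    case (inv k)
    have k: "k \<in> carrier G" using inv by auto
    have "(\<lambda>h. h \<otimes> k) ` R \<subseteq> R"
      using inv lab_R by auto
    moreover have "inj_on (\<lambda>h. h \<otimes> k) R"
      using k R_closed by (auto simp: inj_on_def subset_iff)
    ultimately have *: "(\<lambda>h. h \<otimes> k) ` R = R"
      using finite_subset[OF R_closed finite_G] by (intro endo_inj_surj)
    show ?case
    proof
      fix h assume "h \<in> R"
      with * obtain h' where "h' \<in> R" "h = h' \<otimes> k" by blast
      then show "h \<otimes> inv k \<in> R"
        using k R_closed by (auto simp: m_assoc subset_iff)
    qed
  next
    case (eng k l)
    then have "k \<in> carrier G" "l \<in> carrier G"
      using lab_generates by auto
    with eng R_closed show ?case
      by (simp add: m_assoc[symmetric] subset_iff)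
  qed
  then have "g \<in> R"
    using one assms by force
  then show ?thesis
    using that by (auto simp: R_def)
qed

text \<open>
  A commutative monoid with a transitive orbit acts regularly: two of its elements that agree at
  \<open>\<one>\<close> agree at every point \<open>u(\<one>)\<close>, since \<open>v(u(\<one>)) = u(v(\<one>)) = u(w(\<one>)) = w(u(\<one>))\<close>.
\<close>
lemma run_determined:
  assumes "v \<in> lists X" "w \<in> lists X" "run v \<one> = run w \<one>" "g \<in> carrier G"
  shows "run v g = run w g"
proof -
  obtain u where "u \<in> lists X" "run u \<one> = g"
    using run_reaches assms(4) .
  with run_commute[OF assms(1) this(1) one_closed] run_commute[OF assms(2) this(1) one_closed]
  show ?thesis
    using assms(3) by simp
qed

definition word :: "'a \<Rightarrow> 'x list"
  where "word h = (SOME w. w \<in> lists X \<and> run w \<one> = h)"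

lemma word:
  assumes "h \<in> carrier G"
  shows "word h \<in> lists X" "run (word h) \<one> = h"
  using someI_ex[of "\<lambda>w. w \<in> lists X \<and> run w \<one> = h"] run_reaches[OF assms]
  unfolding word_def by blast+

text \<open>
  Regularity identifies the monoid with \<open>G\<close>, through the value at \<open>\<one>\<close>. Conjugating by the left
  translation by \<open>g\<close> and evaluating at \<open>\<one>\<close> moves the action of \<open>G\<close> on the monoid to \<open>G\<close>. If \<open>X\<close> is
  contained in \<open>G\<close>, this extends the given action.
\<close>
definition extended_act :: "'a \<Rightarrow> 'a \<Rightarrow> 'a"
  where "extended_act g h = g \<otimes> run (word h) (inv g)"

text \<open>
  On words the action is letterwise, for any choice of word; this makes it multiplicative.
\<close>
lemma extended_act_run:
  assumes "g \<in> carrier G" "w \<in> lists X"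
  shows "extended_act g (run w \<one>) = run (map (act g) w) \<one>"
proof -
  have "extended_act g (run w \<one>) = g \<otimes> run w (inv g)"
    using assms word[of "run w \<one>"] run_determined[of "word (run w \<one>)" w "inv g"]
    by (simp add: extended_act_def)
  also have "\<dots> = run (map (act g) w) \<one>"
    using assms run_translate[of w g "inv g"] by simp
  finally show ?thesis .
qed

lemma map_act_lists: "\<lbrakk>g \<in> carrier G; w \<in> lists X\<rbrakk> \<Longrightarrow> map (act g) w \<in> lists X"
  by auto

text \<open>
  The symmetric law is the commutativity of the monoid: \<open>x \<mu>(x)\<^sup>-\<^sup>1(y)\<close> is the endpoint of the run
  along a word for \<open>x\<close> followed by a word for \<open>y\<close>.
\<close>
lemma exists_brace: "\<exists>\<mu>. brace G \<mu>"
proof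
  show "brace G (\<lambda>g. restrict (extended_act g) (carrier G))"
  proof (intro brace.intro brace_axioms.intro group_actionI)
    fix g h x assume gh: "g \<in> carrier G" "h \<in> carrier G" and x: "x \<in> carrier G"
    obtain w where w: "w \<in> lists X" "x = run w \<one>"
      using run_reaches[OF x] by metis
    have "map (act (g \<otimes> h)) w = map (act g) (map (act h) w)"
      using w(1) gh by (induction w) (auto simp: composition_rule)
    then show "extended_act (g \<otimes> h) x = extended_act g (extended_act h x)"
      using gh w by (simp add: extended_act_run map_act_lists del: map_map)
  next
    fix x y assume xy: "x \<in> carrier G" "y \<in> carrier G"
    have *: "x' \<otimes> extended_act (inv x') y' = run (word y') (run (word x') \<one>)"
      if "x' \<in> carrier G" "y' \<in> carrier G" for x' y'
      using that word[OF that(1)] word[OF that(2)]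
      by (simp add: extended_act_def m_assoc[symmetric])
    show "x \<otimes> restrict (extended_act (inv x)) (carrier G) y =
        y \<otimes> restrict (extended_act (inv y)) (carrier G) x"
      using xy * run_commute[OF word(1)[OF xy(1)] word(1)[OF xy(2)] one_closed] by simp
  next
    fix x assume x: "x \<in> carrier G"
    then show "extended_act \<one> x = x"
      using word[OF x] by (simp add: extended_act_def)
  qed (use word in \<open>auto simp: extended_act_def\<close>)
qed

end

section \<open>Each condition gives a brace\<close>

text \<open>
  For groups known only up to isomorphism: the labels are pulled back along \<open>G \<cong> \<langle>l(X)\<rangle>\<close>, and \<open>G\<close>
  acts on \<open>X\<close> through the isomorphism.
\<close>
lemma exists_brace_if_generated:
  assumes K: "group_action K X act"
    and l: "l \<in> X \<rightarrow> carrier K"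
    and commute: "\<And>x y. \<lbrakk>x \<in> X; y \<in> X\<rbrakk> \<Longrightarrow>
      l x \<otimes>\<^bsub>K\<^esub> l (act (inv\<^bsub>K\<^esub> (l x)) y) = l y \<otimes>\<^bsub>K\<^esub> l (act (inv\<^bsub>K\<^esub> (l y)) x)"
    and G: "group G" "finite (carrier G)"
    and iso: "G \<cong> K\<lparr>carrier := generate K (l ` X)\<rparr>"
  shows "\<exists>\<mu>. brace G \<mu>"
proof -
  interpret K: group_action K X act by fact
  interpret K: group K by (rule K.group_G)
  interpret group G by fact
  have gen: "generate K (l ` X) \<subseteq> carrier K"
    using l by (intro K.generate_incl) auto
  from iso obtain \<psi> where \<psi>: "\<psi> \<in> iso G (K\<lparr>carrier := generate K (l ` X)\<rparr>)"
    by (auto simp: is_iso_def)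
  then have \<psi>_bij: "bij_betw \<psi> (carrier G) (generate K (l ` X))"
    by (simp add: iso_def)
  have "\<psi> \<in> hom G K"
    using \<psi> gen by (auto simp: iso_def hom_def Pi_iff)
  then interpret \<psi>: group_hom G K \<psi>
    by unfold_locales
  define lab where "lab = (\<lambda>x. inv_into (carrier G) \<psi> (l x))"
  have l_gen: "l x \<in> \<psi> ` carrier G" if "x \<in> X" for x
    using that \<psi>_bij generate.incl[of "l x" "l ` X" K] by (simp add: bij_betw_def)
  have \<psi>_lab: "\<psi> (lab x) = l x" if "x \<in> X" for x
    unfolding lab_def using l_gen[OF that] by (rule f_inv_into_f)
  have lab_in: "lab x \<in> carrier G" if "x \<in> X" for x
    unfolding lab_def using l_gen[OF that] by (rule inv_into_into)
  have inj: "inj_on \<psi> (carrier G)"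
    using \<psi>_bij by (simp add: bij_betw_def)
  have "iyb_labelling G X (\<lambda>g. act (\<psi> g)) lab"
  proof (intro iyb_labelling.intro iyb_labelling_axioms.intro)
    have "(\<lambda>g. act (\<psi> g)) \<in> hom G (BijGroup X)"
      by (rule homI) (simp_all add: K.action_in_BijGroup K.action_mult)
    then show "group_action G X (\<lambda>g. act (\<psi> g))"
      using G(1) by (simp add: group_action_iff_hom)
    have "\<psi> ` lab ` X = l ` X"
      using \<psi>_lab by (auto simp: image_image)
    moreover have sub: "lab ` X \<subseteq> carrier G"
      using lab_in by auto
    ultimately have "\<psi> ` generate G (lab ` X) = \<psi> ` carrier G"
      using \<psi>.generate_img[OF sub] \<psi>_bij by (simp add: bij_betw_def)
    then show "generate G (lab ` X) = carrier G"
      using inj generate_incl[OF sub] by (simp add: inj_on_image_eq_iff)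
  next
    fix x y assume xy: "x \<in> X" "y \<in> X"
    have *: "\<psi> (lab a \<otimes>\<^bsub>G\<^esub> lab (act (\<psi> (inv\<^bsub>G\<^esub> lab a)) b)) =
        l a \<otimes>\<^bsub>K\<^esub> l (act (inv\<^bsub>K\<^esub> (l a)) b)" if "a \<in> X" "b \<in> X" for a b
    proof -
      have "l a \<in> carrier K" using that l by auto
      then show ?thesis using that by (simp add: lab_in \<psi>_lab)
    qed
    have l': "l x \<in> carrier K" "l y \<in> carrier K" using xy l by auto
    show "lab x \<otimes>\<^bsub>G\<^esub> lab (act (\<psi> (inv\<^bsub>G\<^esub> lab x)) y) =
        lab y \<otimes>\<^bsub>G\<^esub> lab (act (\<psi> (inv\<^bsub>G\<^esub> lab y)) x)"
    proof (rule inj_onD[OF inj])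
      show "\<psi> (lab x \<otimes>\<^bsub>G\<^esub> lab (act (\<psi> (inv\<^bsub>G\<^esub> lab x)) y)) =
          \<psi> (lab y \<otimes>\<^bsub>G\<^esub> lab (act (\<psi> (inv\<^bsub>G\<^esub> lab y)) x))"
        using xy commute by (simp add: *)
    qed (use xy l' in \<open>simp_all add: lab_in \<psi>_lab\<close>)
  qed (use G lab_in in auto)
  then show ?thesis
    by (rule iyb_labelling.exists_brace)
qed

text \<open>
  Labelling \<open>a\<close> by \<open>\<pi>\<^sup>-\<^sup>1(a)\<close>, the cocycle identity turns the product of the labels in either order
  into the label of \<open>a b\<close>, and \<open>A\<close> is abelian.
\<close>
lemma (in group) exists_brace_if_cocycle:
  assumes "finite (carrier G)" "\<alpha> \<in> hom G (AutoGroup A)" "comm_group A"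
    and \<pi>: "one_cocycle G A \<alpha> \<pi>" and bij: "bij_betw \<pi> (carrier G) (carrier A)"
  shows "\<exists>\<mu>. brace G \<mu>"
proof -
  interpret A: comm_group A by fact
  interpret \<alpha>: group_action G "carrier A" \<alpha>
    using is_group assms(2) by (rule hom_AutoGroup_imp_group_action)
  define lab where "lab = inv_into (carrier G) \<pi>"
  have lab_in [simp]: "lab a \<in> carrier G" if "a \<in> carrier A" for a
    using that bij by (simp add: lab_def bij_betw_def inv_into_into)
  have \<pi>_lab [simp]: "\<pi> (lab a) = a" if "a \<in> carrier A" for a
    using that bij by (simp add: lab_def bij_betw_inv_into_right)
  have inj: "inj_on \<pi> (carrier G)"
    using bij by (simp add: bij_betw_def)
  have cocycle: "\<pi> (g \<otimes> h) = \<pi> g \<otimes>\<^bsub>A\<^esub> \<alpha> g (\<pi> h)" if "g \<in> carrier G" "h \<in> carrier G" for g h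
    using \<pi> that by (simp add: one_cocycle_def)
  have "iyb_labelling G (carrier A) \<alpha> lab"
  proof (intro iyb_labelling.intro iyb_labelling_axioms.intro)
    have "lab ` carrier A = carrier G"
      using bij_betw_inv_into[OF bij] by (simp add: lab_def bij_betw_def)
    then show "generate G (lab ` carrier A) = carrier G"
      using generate_incl[of "carrier G"] by (auto intro: generate.incl)
  next
    fix a b assume ab: "a \<in> carrier A" "b \<in> carrier A"
    show "lab a \<otimes> lab (\<alpha> (inv lab a) b) = lab b \<otimes> lab (\<alpha> (inv lab b) a)"
      by (rule inj_onD[OF inj]) (use ab in \<open>simp_all add: cocycle A.m_comm\<close>)
  qed (use assms(1) \<alpha>.group_action_axioms in auto)
  then show ?thesis
    by (rule iyb_labelling.exists_brace)
qed

lemma (in group) exists_brace_if_generating_subset: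
  assumes "finite (carrier G)" "Z \<subseteq> carrier G" "generate G Z = carrier G"
    and \<mu>: "\<mu> \<in> hom G (BijGroup Z)"
    and commute: "\<And>x y. \<lbrakk>x \<in> Z; y \<in> Z\<rbrakk> \<Longrightarrow>
      x \<otimes> (inv\<^bsub>BijGroup Z\<^esub> (\<mu> x)) y = y \<otimes> (inv\<^bsub>BijGroup Z\<^esub> (\<mu> y)) x"
  shows "\<exists>\<mu>. brace G \<mu>"
proof -
  interpret \<mu>: group_action G Z \<mu>
    using \<mu> is_group by (simp add: group_action_iff_hom)
  have "iyb_labelling G Z \<mu> (\<lambda>x. x)"
  proof (intro iyb_labelling.intro iyb_labelling_axioms.intro)
    fix x y assume "x \<in> Z" "y \<in> Z"
    then show "x \<otimes> \<mu> (inv x) y = y \<otimes> \<mu> (inv y) x"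
      using commute[of x y] assms(2) by (simp add: \<mu>.inv_BijGroup_action subset_iff)
  qed (use assms \<mu>.group_action_axioms in auto)
  then show ?thesis
    by (rule iyb_labelling.exists_brace)
qed

lemma (in group) exists_brace_if_IYB_map_generates:
  assumes "finite (carrier G)" "IYB_map X \<Lambda>"
    and "G \<cong> (BijGroup X)\<lparr>carrier := generate (BijGroup X) (\<Lambda> ` X)\<rparr>"
  shows "\<exists>\<mu>. brace G \<mu>"
proof (rule exists_brace_if_generated)
  show "group_action (BijGroup X) X (\<lambda>g. g)"
    by (simp add: group_action_iff_hom group_BijGroup hom_def)
qed (use assms is_group in \<open>auto simp: IYB_map_def\<close>)

lemma Fa_Sym_mult:
  "(a, \<sigma>) \<otimes>\<^bsub>Fa_Sym n\<^esub> (b, \<tau>) = (a + natural_action n \<sigma> b, \<sigma> \<circ> \<tau>)"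
  by (simp add: Fa_Sym_def semidirect_product_def sym_group_mult)

lemma Fa_Sym_one: "\<one>\<^bsub>Fa_Sym n\<^esub> = (0, id)"
  by (simp add: Fa_Sym_def semidirect_product_def sym_group_one)

lemma snd_Fa_Sym_hom: "snd \<in> hom (Fa_Sym n) (sym_group n)"
  by (auto simp: Fa_Sym_def semidirect_product_def hom_def)

text \<open>
  The labelled set is \<open>Fa\<^sub>n\<close>, with \<open>\<phi>\<close> as labelling. Closure of the graph under products says
  \<open>\<phi>(a + \<phi>(a)(b)) = \<phi>(a) \<phi>(b)\<close>; replacing \<open>b\<close> by \<open>\<phi>(a)\<^sup>-\<^sup>1(b)\<close> makes the left side \<open>\<phi>(a + b)\<close>,
  which is symmetric.
\<close>
lemma (in group) exists_brace_if_IYB_group: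
  assumes "finite (carrier G)" "IYB_group G"
  shows "\<exists>\<mu>. brace G \<mu>"
proof -
  from assms(2) obtain n \<phi> where
    \<phi>: "\<phi> \<in> carrier (free_Abelian_group {1..n}) \<rightarrow> carrier (sym_group n)"
    and graph: "subgroup {(a, \<phi> a) |a. a \<in> carrier (free_Abelian_group {1..n})} (Fa_Sym n)"
    and iso: "G \<cong> (sym_group n)\<lparr>carrier := \<phi> ` carrier (free_Abelian_group {1..n})\<rparr>"
    unfolding IYB_group_def by blast
  define F where "F = carrier (free_Abelian_group {1..n})"
  note \<phi> = \<phi>[folded F_def] and graph = graph[folded F_def] and iso = iso[folded F_def]
  interpret S: group "sym_group n" by (rule sym_group_is_group)
  interpret S: group_action "sym_group n" F "natural_action n"
    unfolding F_def using sym_group_is_group natural_action_in_hom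
    by (rule hom_AutoGroup_imp_group_action)
  have mult: "\<phi> (a + natural_action n (\<phi> a) b) = \<phi> a \<otimes>\<^bsub>sym_group n\<^esub> \<phi> b"
    if "a \<in> F" "b \<in> F" for a b
  proof -
    have "(a, \<phi> a) \<otimes>\<^bsub>Fa_Sym n\<^esub> (b, \<phi> b) \<in> {(a, \<phi> a) |a. a \<in> F}"
      by (rule subgroup.m_closed[OF graph]) (use that in auto)
    then show ?thesis by (auto simp: Fa_Sym_mult sym_group_mult)
  qed
  have "subgroup (snd ` {(a, \<phi> a) |a. a \<in> F}) (sym_group n)"
    using snd_Fa_Sym_hom[of n]
    by (intro group_hom.subgroup_img_is_subgroup[OF _ graph])
      (simp add: group_hom_def group_hom_axioms_def group_Fa_Sym sym_group_is_group)
  moreover have "snd ` {(a, \<phi> a) |a. a \<in> F} = \<phi> ` F"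
    by force
  ultimately have "generate (sym_group n) (\<phi> ` F) = \<phi> ` F"
    using S.generateI[of "\<phi> ` F" "\<phi> ` F"] by simp
  then have iso': "G \<cong> (sym_group n)\<lparr>carrier := generate (sym_group n) (\<phi> ` F)\<rparr>"
    using iso by simp
  show ?thesis
  proof (rule exists_brace_if_generated[OF S.group_action_axioms \<phi> _ is_group assms(1) iso'])
    fix a b assume ab: "a \<in> F" "b \<in> F"
    have "\<phi> c \<otimes>\<^bsub>sym_group n\<^esub> \<phi> (natural_action n (inv\<^bsub>sym_group n\<^esub> (\<phi> c)) d) = \<phi> (c + d)"
      if "c \<in> F" "d \<in> F" for c d
    proof -
      have "\<phi> c \<in> carrier (sym_group n)" using that \<phi> by auto
      then show ?thesis
        using that mult[of c "natural_action n (inv\<^bsub>sym_group n\<^esub> (\<phi> c)) d"]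
        by (simp del: sym_group_inv_equality)
    qed
    with ab show "\<phi> a \<otimes>\<^bsub>sym_group n\<^esub> \<phi> (natural_action n (inv\<^bsub>sym_group n\<^esub> (\<phi> a)) b) =
        \<phi> b \<otimes>\<^bsub>sym_group n\<^esub> \<phi> (natural_action n (inv\<^bsub>sym_group n\<^esub> (\<phi> b)) a)"
      by (simp add: add.commute)
  qed
qed

section \<open>The abelian group and the IYB maps of a brace\<close>
lemma (in group_action) IYB_map_if_labelled:
  assumes "finite E" and lab: "lab \<in> E \<rightarrow> carrier G"
    and commute: "\<And>x y. \<lbrakk>x \<in> E; y \<in> E\<rbrakk> \<Longrightarrow>
      lab x \<otimes> lab (\<phi> (inv (lab x)) y) = lab y \<otimes> lab (\<phi> (inv (lab y)) x)"
  shows "IYB_map E (\<lambda>x. \<phi> (lab x))"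
proof -
  interpret group G by (rule group_G)
  have "\<phi> (lab x) \<otimes>\<^bsub>BijGroup E\<^esub> \<phi> (lab ((inv\<^bsub>BijGroup E\<^esub> (\<phi> (lab x))) y)) =
      \<phi> (lab x \<otimes> lab (\<phi> (inv (lab x)) y))" if "x \<in> E" "y \<in> E" for x y
  proof -
    have x: "lab x \<in> carrier G" using that lab by auto
    then have "lab (\<phi> (inv (lab x)) y) \<in> carrier G" using that lab by auto
    with x show ?thesis by (simp add: inv_BijGroup_action action_mult)
  qed
  then show ?thesis
    using assms unfolding IYB_map_def by (auto simp: Pi_iff action_in_BijGroup)
qed

context brace
begin

sublocale group G
  by (rule group_G)

definition add :: "'a \<Rightarrow> 'a \<Rightarrow> 'a"
  where "add x y = x \<otimes> \<mu> (inv x) y"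

lemma add_closed [simp]: "\<lbrakk>x \<in> carrier G; y \<in> carrier G\<rbrakk> \<Longrightarrow> add x y \<in> carrier G"
  by (simp add: add_def)

lemma add_commute: "\<lbrakk>x \<in> carrier G; y \<in> carrier G\<rbrakk> \<Longrightarrow> add x y = add y x"
  by (simp add: add_def brace_commute)

lemma mult_eq_add: "\<lbrakk>x \<in> carrier G; y \<in> carrier G\<rbrakk> \<Longrightarrow> x \<otimes> y = add x (\<mu> x y)"
  by (simp add: add_def)

lemma add_one [simp]: "x \<in> carrier G \<Longrightarrow> add \<one> x = x" "x \<in> carrier G \<Longrightarrow> add x \<one> = x"
  by (simp_all add: add_def brace_commute[of _ \<one>])

text \<open>
  The right side is symmetric in \<open>y\<close> and \<open>z\<close>. Together with commutativity this yields associativity.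
\<close>
lemma add_add:
  assumes "x \<in> carrier G" "y \<in> carrier G" "z \<in> carrier G"
  shows "add (add x y) z = x \<otimes> add (\<mu> (inv x) y) (\<mu> (inv x) z)"
  using assms by (simp add: add_def m_assoc inv_mult_group composition_rule)

lemma add_assoc:
  assumes "x \<in> carrier G" "y \<in> carrier G" "z \<in> carrier G"
  shows "add (add x y) z = add x (add y z)"
proof -
  have "add (add x y) z = add (add y x) z"
    using assms by (simp add: add_commute)
  also have "\<dots> = add (add y z) x"
    using assms add_commute[of "\<mu> (inv y) x" "\<mu> (inv y) z"] by (simp add: add_add)
  also have "\<dots> = add x (add y z)"
    using assms by (simp add: add_commute)
  finally show ?thesis .
qed

text \<open>
  By associativity, \<open>g\<^sup>-\<^sup>1 \<mu>(g)(y + z) = g\<^sup>-\<^sup>1 + (y + z) = (g\<^sup>-\<^sup>1 + y) + z = g\<^sup>-\<^sup>1 (\<mu>(g)(y) + \<mu>(g)(z))\<close>;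
  cancel \<open>g\<^sup>-\<^sup>1\<close>.
\<close>
lemma action_add:
  assumes "g \<in> carrier G" "y \<in> carrier G" "z \<in> carrier G"
  shows "\<mu> g (add y z) = add (\<mu> g y) (\<mu> g z)"
proof -
  have "inv g \<otimes> \<mu> g (add y z) = add (inv g) (add y z)"
    using assms by (simp add: add_def[of "inv g"])
  also have "\<dots> = inv g \<otimes> add (\<mu> g y) (\<mu> g z)"
    using assms add_add[of "inv g" y z] by (simp add: add_assoc)
  finally show ?thesis
    using assms by simp
qed

lemma action_one_right [simp]:
  assumes "g \<in> carrier G"
  shows "\<mu> g \<one> = \<one>"
proof -
  \<comment> \<open>The left side is \<open>\<mu> g \<one>\<close> and the right side is \<open>\<mu> g (\<mu> (inv g) \<one>) = \<one>\<close>.\<close>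
  have "add (\<mu> g \<one>) \<one> = \<mu> g (add \<one> (\<mu> (inv g) \<one>))"
    using assms by (simp add: action_add del: add_one)
  then show ?thesis
    using assms by simp
qed

lemma add_inverse: "x \<in> carrier G \<Longrightarrow> add (\<mu> x (inv x)) x = \<one>"
  using mult_eq_add[of x "inv x"] by (simp add: add_commute)

text \<open>
  The elements are relabelled along an injection \<open>e\<close>, so that the group can live in another type.
  The structure is the one for which \<open>e\<close> becomes a bijective cocycle.
\<close>
definition additive_group :: "('a \<Rightarrow> 'x) \<Rightarrow> 'x monoid"
  where "additive_group e =
    \<lparr>carrier = e ` carrier G,
     monoid.mult = (\<lambda>a b. e (add (inv_into (carrier G) e a) (inv_into (carrier G) e b))),
     one = e \<one>\<rparr>"

lemma additive_group_simps:
  shows "carrier (additive_group e) = e ` carrier G"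
    and "\<one>\<^bsub>additive_group e\<^esub> = e \<one>"
    and "\<lbrakk>inj_on e (carrier G); x \<in> carrier G; y \<in> carrier G\<rbrakk> \<Longrightarrow>
      e x \<otimes>\<^bsub>additive_group e\<^esub> e y = e (add x y)"
  by (simp_all add: additive_group_def)

lemma comm_group_additive_group:
  assumes "inj_on e (carrier G)"
  shows "comm_group (additive_group e)"
proof (rule comm_groupI)
  fix a assume "a \<in> carrier (additive_group e)"
  then obtain x where x: "x \<in> carrier G" "a = e x"
    by (auto simp: additive_group_simps)
  then show "\<exists>b\<in>carrier (additive_group e). b \<otimes>\<^bsub>additive_group e\<^esub> a = \<one>\<^bsub>additive_group e\<^esub>"
    by (intro bexI[of _ "e (\<mu> x (inv x))"])
      (simp_all add: additive_group_simps assms add_inverse)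
next
  fix a b assume "a \<in> carrier (additive_group e)" "b \<in> carrier (additive_group e)"
  then show "a \<otimes>\<^bsub>additive_group e\<^esub> b = b \<otimes>\<^bsub>additive_group e\<^esub> a"
    using add_commute by (auto simp: additive_group_simps assms)
qed (auto simp: additive_group_simps assms add_assoc)

lemma transport_in_hom_AutoGroup:
  assumes e: "inj_on e (carrier G)"
  shows "transport e \<in> hom G (AutoGroup (additive_group e))"
proof -
  interpret T: group_action G "e ` carrier G" "transport e"
    using e by (rule group_action_transport)
  have hom: "transport e g \<in> hom (additive_group e) (additive_group e)" if "g \<in> carrier G" for g
    using that
    by (intro homI) (auto simp: additive_group_simps e transport_apply action_add)
  show ?thesis
    by (rule homI)
      (auto simp: AutoGroup_def auto_def hom T.bij_prop0 T.action_mult additive_group_simps)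
qed

lemma one_cocycle_labels:
  assumes "inj_on e (carrier G)"
  shows "one_cocycle G (additive_group e) (transport e) e"
  using assms by (auto simp: one_cocycle_def additive_group_simps transport_apply mult_eq_add)

text \<open>
  The image of \<open>\<mu>\<close> may be a proper quotient of \<open>G\<close>. Left translation on a second copy of \<open>G\<close> makes
  the action faithful, and labelling that copy by \<open>\<one>\<close> does no harm: the labelling is still
  equivariant, because \<open>\<mu>\<close> fixes \<open>\<one>\<close>.
\<close>
lemma faithful_labelled_action:
  assumes e: "inj_on e (carrier G <+> carrier G)"
  obtains T lab where "group_action G (e ` (carrier G <+> carrier G)) T"
    and "inj_on T (carrier G)"
    and "\<And>g h. \<lbrakk>g \<in> carrier G; h \<in> carrier G\<rbrakk> \<Longrightarrow> T g (e (Inl h)) = e (Inl (\<mu> g h))"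
    and "\<And>h. h \<in> carrier G \<Longrightarrow> lab (e (Inl h)) = h"
    and "\<And>h. h \<in> carrier G \<Longrightarrow> lab (e (Inr h)) = \<one>"
    and "\<And>g y. \<lbrakk>g \<in> carrier G; y \<in> e ` (carrier G <+> carrier G)\<rbrakk> \<Longrightarrow>
      lab (T g y) = \<mu> g (lab y)"
proof -
  let ?E = "carrier G <+> carrier G"
  define d where "d = (\<lambda>g. restrict (case_sum (\<lambda>h. Inl (\<mu> g h)) (\<lambda>h. Inr (g \<otimes> h))) ?E)"
  define lab where "lab = (\<lambda>y. case_sum (\<lambda>h. h) (\<lambda>h. \<one>) (inv_into ?E e y))"
  interpret D: group_action G ?E d
    unfolding d_def by (rule group_actionI[OF is_group]) (auto simp: composition_rule m_assoc)
  have d_Inl: "d g (Inl h) = Inl (\<mu> g h)" and d_Inr: "d g (Inr h) = Inr (g \<otimes> h)"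
    if "h \<in> carrier G" for g h
    using that by (simp_all add: d_def InlI InrI)
  have inj_d: "inj_on d (carrier G)"
  proof (rule inj_onI)
    fix g h assume gh: "g \<in> carrier G" "h \<in> carrier G" "d g = d h"
    then have "d g (Inr \<one>) = d h (Inr \<one>)" by simp
    then show "g = h" using gh(1,2) by (simp add: d_Inr)
  qed
  show thesis
  proof
    show "group_action G (e ` ?E) (D.transport e)"
      using e by (rule D.group_action_transport)
    show "inj_on (D.transport e) (carrier G)"
      using e inj_d by (rule D.inj_on_transport)
    show "D.transport e g (e (Inl h)) = e (Inl (\<mu> g h))"
      if "g \<in> carrier G" "h \<in> carrier G" for g h
      using that by (simp add: D.transport_apply e d_Inl InlI)
    show "lab (D.transport e g y) = \<mu> g (lab y)" if "g \<in> carrier G" "y \<in> e ` ?E" for g y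
    proof -
      from that(2) obtain s where s: "s \<in> ?E" "y = e s" by blast
      then have "lab (D.transport e g y) = case_sum (\<lambda>h. h) (\<lambda>h. \<one>) (d g s)"
        using that(1) D.action_closed[OF that(1) s(1)] unfolding lab_def s(2)
        by (simp only: D.transport_apply[OF e s(1)] inv_into_f_f[OF e])
      then show ?thesis
        using s that(1) e by (auto simp: lab_def d_Inl d_Inr)
    qed
  qed (simp_all add: lab_def e InlI InrI)
qed

text \<open>
  Compose the faithful action with the labelling. By equivariance the defining identity of an IYB
  map reduces to commutativity in the brace.
\<close>
lemma IYB_map_with_trivial_part:
  assumes fin: "finite (carrier G)"
  shows "\<exists>(A :: 'c::infinite set) X \<Lambda>.
    finite A \<and> finite X \<and> IYB_map (A \<union> X) \<Lambda> \<and>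
    subgroup (\<Lambda> ` A) (BijGroup (A \<union> X)) \<and>
    (BijGroup (A \<union> X))\<lparr>carrier := \<Lambda> ` A\<rparr> \<cong> G \<and>
    A \<inter> X = {} \<and>
    (\<forall>x\<in>X. \<Lambda> x = \<one>\<^bsub>BijGroup (A \<union> X)\<^esub>) \<and>
    (\<forall>a\<in>A. \<forall>b\<in>A. \<Lambda> a b \<in> A) \<and>
    inj_on \<Lambda> A"
proof -
  let ?E = "carrier G <+> carrier G"
  obtain e :: "'a + 'a \<Rightarrow> 'c" where e: "inj_on e ?E"
    using arb_inj_on_finite_infinite[of ?E] fin by auto
  define A where "A = e ` Inl ` carrier G"
  define X where "X = e ` Inr ` carrier G"
  have fin_A: "finite A" and fin_X: "finite X"
    using fin by (simp_all add: A_def X_def)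
  have AX: "e ` ?E = A \<union> X"
    by (auto simp: A_def X_def Plus_def)
  obtain T lab where T: "group_action G (A \<union> X) T" and inj: "inj_on T (carrier G)"
    and T_Inl: "\<And>g h. \<lbrakk>g \<in> carrier G; h \<in> carrier G\<rbrakk> \<Longrightarrow> T g (e (Inl h)) = e (Inl (\<mu> g h))"
    and lab_Inl: "\<And>h. h \<in> carrier G \<Longrightarrow> lab (e (Inl h)) = h"
    and lab_Inr: "\<And>h. h \<in> carrier G \<Longrightarrow> lab (e (Inr h)) = \<one>"
    and lab_T: "\<And>g y. \<lbrakk>g \<in> carrier G; y \<in> A \<union> X\<rbrakk> \<Longrightarrow> lab (T g y) = \<mu> g (lab y)"
    by (rule faithful_labelled_action[OF e, unfolded AX]) blast
  interpret T: group_action G "A \<union> X" T by fact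
  have lab: "lab y \<in> carrier G" if "y \<in> A \<union> X" for y
    using that lab_Inl lab_Inr by (auto simp: A_def X_def)
  have \<Lambda>_A: "(\<lambda>y. T (lab y)) ` A = T ` carrier G"
    by (force simp: A_def lab_Inl image_image)
  have IYB: "IYB_map (A \<union> X) (\<lambda>y. T (lab y))"
  proof (rule T.IYB_map_if_labelled)
    show "finite (A \<union> X)"
      using fin_A fin_X by simp
  qed (use lab in \<open>auto simp: lab_T brace_commute\<close>)
  have sub: "subgroup (T ` carrier G) (BijGroup (A \<union> X))"
    by (rule group_hom.img_is_subgroup[OF T.group_hom])
  have "T \<in> iso G (BijGroup (A \<union> X)\<lparr>carrier := T ` carrier G\<rparr>)"
    using inj by (auto simp: iso_def hom_def T.action_mult bij_betw_def)
  then have iso: "BijGroup (A \<union> X)\<lparr>carrier := T ` carrier G\<rparr> \<cong> G"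
    using iso_sym unfolding is_iso_def by blast
  have disj: "A \<inter> X = {}"
    using inj_on_image_Int[OF e, of "Inl ` carrier G" "Inr ` carrier G"]
    by (auto simp: A_def X_def Plus_def)
  show ?thesis
  proof (intro exI conjI)
    show "\<forall>x\<in>X. T (lab x) = \<one>\<^bsub>BijGroup (A \<union> X)\<^esub>"
      using group_hom.hom_one[OF T.group_hom] by (auto simp: X_def lab_Inr)
    show "\<forall>a\<in>A. \<forall>b\<in>A. T (lab a) b \<in> A"
      by (auto simp: A_def lab_Inl T_Inl)
    show "inj_on (\<lambda>y. T (lab y)) A"
      using inj by (auto simp: A_def inj_on_def lab_Inl)
  qed (use fin_A fin_X IYB sub iso disj in \<open>simp_all only: \<Lambda>_A\<close>)
qed

end

lemma free_Abelian_group_hom_eqI: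
  assumes "group H" and h: "h \<in> hom (free_Abelian_group S) H" "h' \<in> hom (free_Abelian_group S) H"
    and eq: "\<And>x. x \<in> S \<Longrightarrow> h (frag_of x) = h' (frag_of x)"
    and a: "a \<in> carrier (free_Abelian_group S)"
  shows "h a = h' a"
proof -
  interpret F: group "free_Abelian_group S" by simp
  interpret H: group H by fact
  interpret h: group_hom "free_Abelian_group S" H h by unfold_locales (rule h)
  interpret h': group_hom "free_Abelian_group S" H h' by unfold_locales (rule h)
  from a have "Poly_Mapping.keys a \<subseteq> S" by simp
  then have "a \<in> carrier (free_Abelian_group S) \<and> h a = h' a"
  proof (induction rule: frag_induction)
    case zero
    show ?case using h.hom_one h'.hom_one F.one_closed by simp
  next
    case (one x)
    then show ?case using eq by simp
  next
    case (diff a b)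
    have "a - b = a \<otimes>\<^bsub>free_Abelian_group S\<^esub> inv\<^bsub>free_Abelian_group S\<^esub> b"
      using diff by simp
    with diff show ?case
      by (simp del: carrier_free_Abelian_group_iff mult_free_Abelian_group inv_free_Abelian_group)
  qed
  then show ?thesis ..
qed

context brace
begin

text \<open>
  Number the two copies of \<open>G\<close> by \<open>{1..n}\<close>. The labelling of \<open>{1..n}\<close> extends to a homomorphism \<open>f\<close>
  from \<open>Fa\<^sub>n\<close> to the additive group, which is equivariant because it is so on the basis, and \<open>\<phi>\<close> is \<open>f\<close>
  followed by the faithful action \<open>\<nu>\<close>. Then \<open>f(a + \<phi>(a)(b)) = f(a) + \<mu>(f(a))(f(b)) = f(a) f(b)\<close>,
  so that the graph of \<open>\<phi>\<close> is closed under products.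
\<close>
lemma IYB_group_if_finite:
  assumes fin: "finite (carrier G)"
  shows "IYB_group G"
proof -
  let ?E = "carrier G <+> carrier G"
  define n where "n = card ?E"
  have n: "n > 0"
    using fin one_closed by (auto simp: n_def card_gt_0_iff)
  have "\<exists>e. bij_betw e ?E {1..n}"
    using fin by (intro finite_same_card_bij) (simp_all add: n_def)
  then obtain e where "bij_betw e ?E {1..n}" ..
  then have e: "inj_on e ?E" and E: "e ` ?E = {1..n}"
    by (auto simp: bij_betw_def)
  obtain T lab where T: "group_action G {1..n} T" and inj: "inj_on T (carrier G)"
    and "\<And>g h. \<lbrakk>g \<in> carrier G; h \<in> carrier G\<rbrakk> \<Longrightarrow> T g (e (Inl h)) = e (Inl (\<mu> g h))"
    and lab_Inl: "\<And>h. h \<in> carrier G \<Longrightarrow> lab (e (Inl h)) = h"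
    and lab_Inr: "\<And>h. h \<in> carrier G \<Longrightarrow> lab (e (Inr h)) = \<one>"
    and lab_T: "\<And>g y. \<lbrakk>g \<in> carrier G; y \<in> {1..n}\<rbrakk> \<Longrightarrow> lab (T g y) = \<mu> g (lab y)"
    by (rule faithful_labelled_action[OF e, unfolded E]) blast
  interpret T: group_action G "{1..n}" T by fact
  have lab: "lab y \<in> carrier G" if "y \<in> {1..n}" for y
    using that lab_Inl lab_Inr unfolding E[symmetric] by (auto simp: Plus_def)

  define F where "F = free_Abelian_group {1..n}"
  define A where "A = additive_group (\<lambda>x. x)"
  have carrier_A: "carrier A = carrier G" and one_A: "\<one>\<^bsub>A\<^esub> = \<one>"
    and mult_A: "\<And>x y. \<lbrakk>x \<in> carrier G; y \<in> carrier G\<rbrakk> \<Longrightarrow> x \<otimes>\<^bsub>A\<^esub> y = add x y"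
    using additive_group_simps[of "\<lambda>x. x"] by (simp_all add: A_def)
  interpret A: comm_group A
    unfolding A_def by (rule comm_group_additive_group) simp
  have lab_img: "lab ` {1..n} \<subseteq> carrier A"
    using lab by (auto simp: carrier_A)
  obtain f where f: "f \<in> hom F A" and f_of: "\<And>i. i \<in> {1..n} \<Longrightarrow> f (frag_of i) = lab i"
    unfolding F_def by (rule A.free_Abelian_group_universal[OF lab_img]) blast
  have f_in: "f a \<in> carrier G" if "a \<in> carrier F" for a
    using f that carrier_A by (auto simp: hom_def)

  define \<nu> where "\<nu> = (\<lambda>g i. if i \<in> {1..n} then T g i else i)"
  have \<nu>: "\<nu> \<in> hom G (sym_group n)"
    unfolding \<nu>_def by (rule hom_sym_group) fact
  interpret \<nu>: group_hom G "sym_group n" \<nu>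
    by (intro group_hom.intro group_hom_axioms.intro is_group \<nu> sym_group_is_group)
  have nat: "natural_action n (\<nu> g) \<in> hom F F" if "g \<in> carrier G" for g
    using hom_in_carrier[OF natural_action_in_hom \<nu>.hom_closed[OF that]]
    by (simp add: AutoGroup_def auto_def F_def)
  have f_equivariant: "f (natural_action n (\<nu> g) a) = \<mu> g (f a)"
    if g: "g \<in> carrier G" and a: "a \<in> carrier F" for g a
  proof -
    have "(f \<circ> natural_action n (\<nu> g)) a = (\<mu> g \<circ> f) a"
    proof (rule free_Abelian_group_hom_eqI)
      show "f \<circ> natural_action n (\<nu> g) \<in> hom (free_Abelian_group {1..n}) A"
        using Group.hom_compose[OF nat[OF g] f] by (simp add: F_def)
      have "\<mu> g \<in> hom A A"
        using g by (intro homI) (simp_all add: carrier_A mult_A action_add)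
      from Group.hom_compose[OF f this] show "\<mu> g \<circ> f \<in> hom (free_Abelian_group {1..n}) A"
        by (simp add: F_def)
      fix i assume i: "i \<in> {1..n}"
      have "natural_action n (\<nu> g) (frag_of i) = frag_of (T g i)"
        using i by (simp add: natural_action_def \<nu>_def)
      then show "(f \<circ> natural_action n (\<nu> g)) (frag_of i) = (\<mu> g \<circ> f) (frag_of i)"
        using f_of i g lab_T T.action_closed[OF g i] by simp
    qed (use a A.is_group F_def in auto)
    then show ?thesis by simp
  qed

  define \<phi> where "\<phi> = (\<lambda>a. \<nu> (f a))"
  have \<phi>_in: "\<phi> a \<in> carrier (sym_group n)" if "a \<in> carrier F" for a
    using that f_in by (simp add: \<phi>_def)
  have nat_closed: "natural_action n (\<phi> a) b \<in> carrier F" if "a \<in> carrier F" "b \<in> carrier F" for a b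
    using hom_in_carrier[OF nat[OF f_in]] that by (simp add: \<phi>_def)
  have F_group: "group F" by (simp add: F_def)
  have F_mult: "a \<otimes>\<^bsub>F\<^esub> b = a + b" for a b by (simp add: F_def)
  have mult: "\<phi> (a + natural_action n (\<phi> a) b) = \<phi> a \<circ> \<phi> b"
    if a: "a \<in> carrier F" and b: "b \<in> carrier F" for a b
  proof -
    have "f (a + natural_action n (\<phi> a) b) = f a \<otimes>\<^bsub>A\<^esub> f (natural_action n (\<phi> a) b)"
      using hom_mult[OF f a nat_closed[OF a b]] by (simp add: F_mult)
    also have "\<dots> = add (f a) (\<mu> (f a) (f b))"
      using a b f_in nat_closed by (simp add: mult_A f_equivariant \<phi>_def)
    also have "\<dots> = f a \<otimes> f b"
      using a b f_in by (simp add: mult_eq_add)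
    finally show ?thesis
      using a b f_in by (simp add: \<phi>_def sym_group_mult)
  qed
  interpret FS: group "Fa_Sym n" by (rule group_Fa_Sym)
  have FS_carrier: "carrier (Fa_Sym n) = carrier F \<times> carrier (sym_group n)"
    by (simp add: Fa_Sym_def semidirect_product_def F_def)
  interpret N: group_action "sym_group n" "carrier F" "natural_action n"
    unfolding F_def using sym_group_is_group natural_action_in_hom
    by (rule hom_AutoGroup_imp_group_action)
  have \<phi>_zero: "\<phi> 0 = id"
    using hom_one[OF f F_group A.is_group] \<nu>.hom_one
    by (simp add: \<phi>_def F_def one_A sym_group_one)
  have graph: "subgroup {(a, \<phi> a) |a. a \<in> carrier F} (Fa_Sym n)"
  proof (rule FS.subgroupI)
    show "{(a, \<phi> a) |a. a \<in> carrier F} \<noteq> {}"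
      using group.is_monoid[OF F_group] monoid.one_closed by blast
  next
    fix p assume "p \<in> {(a, \<phi> a) |a. a \<in> carrier F}"
    then obtain a where a: "a \<in> carrier F" "p = (a, \<phi> a)" by blast
    \<comment> \<open>The inverse of \<open>(a, \<sigma>)\<close> in the semidirect product has first component \<open>\<sigma>\<^sup>-\<^sup>1(- a)\<close>.\<close>
    define b where "b = natural_action n (inv\<^bsub>sym_group n\<^esub> (\<phi> a)) (inv\<^bsub>F\<^esub> a)"
    have inv_a: "inv\<^bsub>F\<^esub> a \<in> carrier F"
      using F_group a(1) by (rule group.inv_closed)
    have b: "b \<in> carrier F"
      unfolding b_def using inv_a \<phi>_in[OF a(1)]
      by (intro N.action_closed group.inv_closed[OF sym_group_is_group])
    have ab: "a + natural_action n (\<phi> a) b = 0"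
      using group.r_inv[OF F_group a(1)] inv_a \<phi>_in[OF a(1)]
      by (simp add: b_def F_mult[symmetric] F_def del: mult_free_Abelian_group inv_free_Abelian_group sym_group_inv_equality)
    have in_FS: "p \<in> carrier (Fa_Sym n)" "(b, \<phi> b) \<in> carrier (Fa_Sym n)"
      using a b \<phi>_in by (simp_all add: FS_carrier)
    have "p \<otimes>\<^bsub>Fa_Sym n\<^esub> (b, \<phi> b) = \<one>\<^bsub>Fa_Sym n\<^esub>"
      using mult[OF a(1) b] ab by (simp add: a(2) Fa_Sym_mult Fa_Sym_one \<phi>_zero)
    from FS.inv_equality[OF FS.inv_comm[OF this in_FS] in_FS]
    have "inv\<^bsub>Fa_Sym n\<^esub> p = (b, \<phi> b)" .
    then show "inv\<^bsub>Fa_Sym n\<^esub> p \<in> {(a, \<phi> a) |a. a \<in> carrier F}"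
      using b by blast
  next
    fix p q assume "p \<in> {(a, \<phi> a) |a. a \<in> carrier F}" "q \<in> {(a, \<phi> a) |a. a \<in> carrier F}"
    then obtain a b where a: "a \<in> carrier F" "p = (a, \<phi> a)" and b: "b \<in> carrier F" "q = (b, \<phi> b)"
      by blast
    have "a + natural_action n (\<phi> a) b \<in> carrier F"
      using monoid.m_closed[OF group.is_monoid[OF F_group] a(1) nat_closed[OF a(1) b(1)]]
      by (simp only: F_mult)
    then show "p \<otimes>\<^bsub>Fa_Sym n\<^esub> q \<in> {(a, \<phi> a) |a. a \<in> carrier F}"
      using a b mult[OF a(1) b(1)] by (auto simp: Fa_Sym_mult)
  qed (use \<phi>_in in \<open>auto simp: FS_carrier\<close>)

  have "f ` carrier F = carrier G"
  proof
    show "carrier G \<subseteq> f ` carrier F"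
    proof
      fix g assume g: "g \<in> carrier G"
      then have i: "e (Inl g) \<in> {1..n}" unfolding E[symmetric] by blast
      then have "f (frag_of (e (Inl g))) = g"
        using g f_of lab_Inl by simp
      moreover have "frag_of (e (Inl g)) \<in> carrier F"
        using i by (simp add: F_def)
      ultimately show "g \<in> f ` carrier F" by force
    qed
  qed (use f_in in blast)
  then have \<phi>_image: "\<phi> ` carrier F = \<nu> ` carrier G"
    unfolding \<phi>_def by (metis image_image)
  have "inj_on \<nu> (carrier G)"
  proof (rule inj_onI)
    fix g h assume gh: "g \<in> carrier G" "h \<in> carrier G" "\<nu> g = \<nu> h"
    have "T g = T h"
    proof (rule extensionalityI)
      show "T g \<in> extensional {1..n}" "T h \<in> extensional {1..n}"
        using gh T.bij_prop0 by (simp_all add: Bij_def)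
      show "T g i = T h i" if "i \<in> {1..n}" for i
        using fun_cong[OF gh(3), of i] that by (simp add: \<nu>_def)
    qed
    then show "g = h"
      using gh inj by (simp add: inj_on_eq_iff)
  qed
  then have "\<nu> \<in> iso G (sym_group n\<lparr>carrier := \<phi> ` carrier F\<rparr>)"
    by (auto simp: \<phi>_image iso_def hom_def bij_betw_def)
  then have iso: "G \<cong> sym_group n\<lparr>carrier := \<phi> ` carrier F\<rparr>"
    unfolding is_iso_def by blast
  show ?thesis
    unfolding IYB_group_def
    by (intro exI[of _ n] conjI n bexI[of _ \<phi>] graph[unfolded F_def] iso[unfolded F_def])
      (use \<phi>_in[unfolded F_def] in blast)
qed

end

section \<open>The equivalences\<close>
lemma (in brace) bijective_cocycle:
  assumes "finite (carrier G)"
  shows "\<exists>(A :: 'x::infinite monoid) \<alpha> \<pi>.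
    comm_group A \<and> \<alpha> \<in> hom G (AutoGroup A) \<and>
    one_cocycle G A \<alpha> \<pi> \<and> bij_betw \<pi> (carrier G) (carrier A)"
proof -
  obtain e :: "'a \<Rightarrow> 'x" where e: "inj_on e (carrier G)"
    using arb_inj_on_finite_infinite[OF assms] by blast
  then have "bij_betw e (carrier G) (carrier (additive_group e))"
    by (simp add: additive_group_simps bij_betw_def)
  then show ?thesis
    using comm_group_additive_group[OF e] transport_in_hom_AutoGroup[OF e] one_cocycle_labels[OF e]
    by blast
qed

text \<open>
  The second component of a product in \<open>A \<rtimes> G\<close> is the product in \<open>G\<close>, and the first component is
  the cocycle rule. Hence the homomorphic sections of \<open>A \<rtimes> G \<rightarrow> G\<close> are the graphs of cocycles.
\<close>
lemma cocycle_section: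
  assumes "one_cocycle G A \<alpha> \<pi>"
  shows "(\<lambda>g. (\<pi> g, g)) \<in> hom G (semidirect_product A G \<alpha>)"
  using assms by (auto simp: one_cocycle_def semidirect_product_def hom_def)

lemma section_cocycle:
  assumes \<rho>: "\<rho> \<in> hom G (semidirect_product A G \<alpha>)"
    and snd: "\<And>g. g \<in> carrier G \<Longrightarrow> snd (\<rho> g) = g"
  shows "one_cocycle G A \<alpha> (\<lambda>g. fst (\<rho> g))"
  unfolding one_cocycle_def
proof (intro conjI ballI)
  show "(\<lambda>g. fst (\<rho> g)) \<in> carrier G \<rightarrow> carrier A"
    using \<rho> by (force simp: hom_def semidirect_product_def)
  fix g h assume gh: "g \<in> carrier G" "h \<in> carrier G"
  show "fst (\<rho> (g \<otimes>\<^bsub>G\<^esub> h)) = fst (\<rho> g) \<otimes>\<^bsub>A\<^esub> \<alpha> g (fst (\<rho> h))"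
    using hom_mult[OF \<rho> gh] snd[OF gh(1)]
    by (simp add: semidirect_product_def case_prod_beta)
qed

lemma (in group) exists_brace_iff_bijective_cocycle:
  assumes "finite (carrier G)"
  shows "(\<exists>\<mu>. brace G \<mu>) \<longleftrightarrow>
    (\<exists>(A :: 'x::infinite monoid) \<alpha> \<pi>.
      comm_group A \<and> \<alpha> \<in> hom G (AutoGroup A) \<and>
      one_cocycle G A \<alpha> \<pi> \<and> bij_betw \<pi> (carrier G) (carrier A))"
  using exists_brace_if_cocycle[OF assms] brace.bijective_cocycle[OF _ assms] by blast

lemma (in group) exists_brace_iff_section:
  assumes "finite (carrier G)"
  shows "(\<exists>\<mu>. brace G \<mu>) \<longleftrightarrow>
    (\<exists>(A :: 'x::infinite monoid) \<alpha> \<rho>.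
      comm_group A \<and> \<alpha> \<in> hom G (AutoGroup A) \<and>
      \<rho> \<in> hom G (semidirect_product A G \<alpha>) \<and>
      (\<forall>g\<in>carrier G. snd (\<rho> g) = g) \<and>
      bij_betw (\<lambda>g. fst (\<rho> g)) (carrier G) (carrier A))"
    (is "_ \<longleftrightarrow> ?section")
  unfolding exists_brace_iff_bijective_cocycle[OF assms, where 'x = 'x]
proof
  assume "\<exists>(A :: 'x monoid) \<alpha> \<pi>.
      comm_group A \<and> \<alpha> \<in> hom G (AutoGroup A) \<and>
      one_cocycle G A \<alpha> \<pi> \<and> bij_betw \<pi> (carrier G) (carrier A)"
  then obtain A :: "'x monoid" and \<alpha> \<pi> where A: "comm_group A" "\<alpha> \<in> hom G (AutoGroup A)"
    and \<pi>: "one_cocycle G A \<alpha> \<pi>" "bij_betw \<pi> (carrier G) (carrier A)"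
    by blast
  show ?section
    by (intro exI[of _ A] exI[of _ \<alpha>] exI[of _ "\<lambda>g. (\<pi> g, g)"])
      (simp add: A \<pi> cocycle_section)
next
  assume ?section
  then show "\<exists>(A :: 'x monoid) \<alpha> \<pi>.
      comm_group A \<and> \<alpha> \<in> hom G (AutoGroup A) \<and>
      one_cocycle G A \<alpha> \<pi> \<and> bij_betw \<pi> (carrier G) (carrier A)"
    using section_cocycle[of _ G] by blast
qed

lemma IYB_map_image_if_trivial_part:
  assumes "group G" and IYB: "IYB_map (A \<union> X) \<Lambda>" and sub: "subgroup (\<Lambda> ` A) (BijGroup (A \<union> X))"
    and iso: "(BijGroup (A \<union> X))\<lparr>carrier := \<Lambda> ` A\<rparr> \<cong> G"
    and trivial: "\<And>x. x \<in> X \<Longrightarrow> \<Lambda> x = \<one>\<^bsub>BijGroup (A \<union> X)\<^esub>"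
  shows "subgroup (\<Lambda> ` (A \<union> X)) (BijGroup (A \<union> X))"
    and "G \<cong> (BijGroup (A \<union> X))\<lparr>carrier := \<Lambda> ` (A \<union> X)\<rparr>"
proof -
  have "\<Lambda> x \<in> \<Lambda> ` A" if "x \<in> X" for x
    using trivial[OF that] subgroup.one_closed[OF sub] by simp
  then have img: "\<Lambda> ` (A \<union> X) = \<Lambda> ` A"
    by blast
  have "group ((BijGroup (A \<union> X))\<lparr>carrier := \<Lambda> ` A\<rparr>)"
    using sub group_BijGroup by (rule subgroup.subgroup_is_group)
  from group.iso_sym[OF this iso] sub
  show "subgroup (\<Lambda> ` (A \<union> X)) (BijGroup (A \<union> X))"
    and "G \<cong> (BijGroup (A \<union> X))\<lparr>carrier := \<Lambda> ` (A \<union> X)\<rparr>"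
    by (simp_all only: img)
qed

lemma generate_BijGroup_subgroup:
  "subgroup H (BijGroup X) \<Longrightarrow> generate (BijGroup X) H = H"
  using group.generateI[OF group_BijGroup, of H X H] by simp

text \<open>
  The conditions on IYB maps weaken from the first to the last, and the last still gives a brace,
  which gives back the first over any infinite type of points.
\<close>
lemma (in group) exists_brace_iff_IYB_map:
  assumes fin: "finite (carrier G)"
  shows "(\<exists>\<mu>. brace G \<mu>) \<longleftrightarrow>
    (\<exists>(A :: 'x::infinite set) X \<Lambda>.
      finite A \<and> finite X \<and> IYB_map (A \<union> X) \<Lambda> \<and>
      subgroup (\<Lambda> ` A) (BijGroup (A \<union> X)) \<and>
      (BijGroup (A \<union> X))\<lparr>carrier := \<Lambda> ` A\<rparr> \<cong> G \<and>
      A \<inter> X = {} \<and>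
      (\<forall>x\<in>X. \<Lambda> x = \<one>\<^bsub>BijGroup (A \<union> X)\<^esub>) \<and>
      (\<forall>a\<in>A. \<forall>b\<in>A. \<Lambda> a b \<in> A) \<and>
      inj_on \<Lambda> A)" (is ?four)
  and "(\<exists>\<mu>. brace G \<mu>) \<longleftrightarrow>
    (\<exists>(X :: 'x set) \<Lambda>.
      finite X \<and> IYB_map X \<Lambda> \<and>
      subgroup (\<Lambda> ` X) (BijGroup X) \<and>
      G \<cong> (BijGroup X)\<lparr>carrier := \<Lambda> ` X\<rparr>)" (is ?five)
  and "(\<exists>\<mu>. brace G \<mu>) \<longleftrightarrow>
    (\<exists>(X :: 'x set) \<Lambda>.
      finite X \<and> IYB_map X \<Lambda> \<and>
      G \<cong> (BijGroup X)\<lparr>carrier := generate (BijGroup X) (\<Lambda> ` X)\<rparr>)" (is ?six)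
proof -
  let ?P4 = "\<lambda>(A :: 'x set) X \<Lambda>.
      finite A \<and> finite X \<and> IYB_map (A \<union> X) \<Lambda> \<and>
      subgroup (\<Lambda> ` A) (BijGroup (A \<union> X)) \<and>
      (BijGroup (A \<union> X))\<lparr>carrier := \<Lambda> ` A\<rparr> \<cong> G \<and>
      A \<inter> X = {} \<and>
      (\<forall>x\<in>X. \<Lambda> x = \<one>\<^bsub>BijGroup (A \<union> X)\<^esub>) \<and>
      (\<forall>a\<in>A. \<forall>b\<in>A. \<Lambda> a b \<in> A) \<and>
      inj_on \<Lambda> A"
  let ?P5 = "\<lambda>(X :: 'x set) \<Lambda>. finite X \<and> IYB_map X \<Lambda> \<and>
      subgroup (\<Lambda> ` X) (BijGroup X) \<and> G \<cong> (BijGroup X)\<lparr>carrier := \<Lambda> ` X\<rparr>"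
  let ?P6 = "\<lambda>(X :: 'x set) \<Lambda>. finite X \<and> IYB_map X \<Lambda> \<and>
      G \<cong> (BijGroup X)\<lparr>carrier := generate (BijGroup X) (\<Lambda> ` X)\<rparr>"
  have brace_P4: "\<exists>A X \<Lambda>. ?P4 A X \<Lambda>" if "\<exists>\<mu>. brace G \<mu>"
    using that by (elim exE) (rule brace.IYB_map_with_trivial_part[OF _ fin])
  have "?P5 (A \<union> X) \<Lambda>" if "?P4 A X \<Lambda>" for A X \<Lambda>
    using that IYB_map_image_if_trivial_part[OF is_group, of A X \<Lambda>] by blast
  then have P4_P5: "\<exists>X \<Lambda>. ?P5 X \<Lambda>" if "\<exists>A X \<Lambda>. ?P4 A X \<Lambda>"
    using that by blast
  have "?P6 X \<Lambda>" if "?P5 X \<Lambda>" for X \<Lambda>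
    using that by (simp add: generate_BijGroup_subgroup)
  then have P5_P6: "\<exists>X \<Lambda>. ?P6 X \<Lambda>" if "\<exists>X \<Lambda>. ?P5 X \<Lambda>"
    using that by blast
  have P6_brace: "\<exists>\<mu>. brace G \<mu>" if "\<exists>X \<Lambda>. ?P6 X \<Lambda>"
    using that exists_brace_if_IYB_map_generates[OF fin] by blast
  show ?four
    by (rule iffI[OF brace_P4 P6_brace[OF P5_P6[OF P4_P5]]])
  show ?five
    by (rule iffI[OF P4_P5[OF brace_P4] P6_brace[OF P5_P6]])
  show ?six
    by (rule iffI[OF P5_P6[OF P4_P5[OF brace_P4]] P6_brace])
qed

lemma (in group) exists_brace_iff_permutation_action:
  "(\<exists>\<mu>. brace G \<mu>) \<longleftrightarrow>
    (\<exists>\<mu> \<in> hom G (BijGroup (carrier G)).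
      \<forall>x\<in>carrier G. \<forall>y\<in>carrier G.
        x \<otimes> (inv\<^bsub>BijGroup (carrier G)\<^esub> (\<mu> x)) y =
        y \<otimes> (inv\<^bsub>BijGroup (carrier G)\<^esub> (\<mu> y)) x)"
proof -
  have "brace G \<mu> \<longleftrightarrow> \<mu> \<in> hom G (BijGroup (carrier G)) \<and>
      (\<forall>x\<in>carrier G. \<forall>y\<in>carrier G.
        x \<otimes> (inv\<^bsub>BijGroup (carrier G)\<^esub> (\<mu> x)) y =
        y \<otimes> (inv\<^bsub>BijGroup (carrier G)\<^esub> (\<mu> y)) x)" for \<mu>
    unfolding brace_def brace_axioms_def group_action_iff_hom[OF is_group, symmetric]
    by (auto simp: group_action.inv_BijGroup_action)
  then show ?thesis by blast
qed

lemma (in group) exists_brace_iff_generating_subset: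
  assumes "finite (carrier G)"
  shows "(\<exists>\<mu>. brace G \<mu>) \<longleftrightarrow>
    (\<exists>Z \<mu>. Z \<subseteq> carrier G \<and> generate G Z = carrier G \<and>
      \<mu> \<in> hom G (BijGroup Z) \<and>
      (\<forall>x\<in>Z. \<forall>y\<in>Z.
        x \<otimes> (inv\<^bsub>BijGroup Z\<^esub> (\<mu> x)) y =
        y \<otimes> (inv\<^bsub>BijGroup Z\<^esub> (\<mu> y)) x))" (is "?brace \<longleftrightarrow> ?subset")
proof
  assume ?brace
  moreover have "generate G (carrier G) = carrier G"
    using generate_incl[of "carrier G"] by (auto intro: generate.incl)
  ultimately show ?subset
    unfolding exists_brace_iff_permutation_action by blast
next
  assume ?subset
  then obtain Z \<mu> where *: "Z \<subseteq> carrier G" "generate G Z = carrier G" "\<mu> \<in> hom G (BijGroup Z)"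
    "\<And>x y. \<lbrakk>x \<in> Z; y \<in> Z\<rbrakk> \<Longrightarrow>
      x \<otimes> (inv\<^bsub>BijGroup Z\<^esub> (\<mu> x)) y = y \<otimes> (inv\<^bsub>BijGroup Z\<^esub> (\<mu> y)) x"
    by blast
  show ?brace
    by (rule exists_brace_if_generating_subset[OF assms *])
qed

lemma (in group) IYB_group_iff_exists_brace:
  assumes "finite (carrier G)"
  shows "IYB_group G \<longleftrightarrow> (\<exists>\<mu>. brace G \<mu>)"
  using exists_brace_if_IYB_group[OF assms] brace.IYB_group_if_finite[OF _ assms] by blast

theorem theorem2p1:
  fixes G :: "('g, 'm) monoid_scheme" (structure)
  assumes "group G" and "finite (carrier G)"
  shows
    \<comment> \<open>(1) iff (2)\<close>
    "(IYB_group G \<longleftrightarrow>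
       (\<exists>(A :: 'a::infinite monoid) \<alpha> \<rho>.
          comm_group A \<and> \<alpha> \<in> hom G (AutoGroup A) \<and>
          \<rho> \<in> hom G (semidirect_product A G \<alpha>) \<and>
          (\<forall>g\<in>carrier G. snd (\<rho> g) = g) \<and>
          bij_betw (\<lambda>g. fst (\<rho> g)) (carrier G) (carrier A)))
     \<and> \<comment> \<open>(1) iff (3)\<close>
     (IYB_group G \<longleftrightarrow>
       (\<exists>(A :: 'b::infinite monoid) \<alpha> \<pi>.
          comm_group A \<and> \<alpha> \<in> hom G (AutoGroup A) \<and>
          one_cocycle G A \<alpha> \<pi> \<and> bij_betw \<pi> (carrier G) (carrier A)))
     \<and> \<comment> \<open>(1) iff (4)\<close>
     (IYB_group G \<longleftrightarrow>
       (\<exists>(A :: 'c::infinite set) X \<Lambda>.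
          finite A \<and> finite X \<and> IYB_map (A \<union> X) \<Lambda> \<and>
          subgroup (\<Lambda> ` A) (BijGroup (A \<union> X)) \<and>
          (BijGroup (A \<union> X))\<lparr>carrier := \<Lambda> ` A\<rparr> \<cong> G \<and>
          A \<inter> X = {} \<and>
          (\<forall>x\<in>X. \<Lambda> x = \<one>\<^bsub>BijGroup (A \<union> X)\<^esub>) \<and>
          (\<forall>a\<in>A. \<forall>b\<in>A. \<Lambda> a b \<in> A) \<and>
          inj_on \<Lambda> A))
     \<and> \<comment> \<open>(1) iff (5)\<close>
     (IYB_group G \<longleftrightarrow>
       (\<exists>(X :: 'd::infinite set) \<Lambda>.
          finite X \<and> IYB_map X \<Lambda> \<and>
          subgroup (\<Lambda> ` X) (BijGroup X) \<and>
          G \<cong> (BijGroup X)\<lparr>carrier := \<Lambda> ` X\<rparr>))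
     \<and> \<comment> \<open>(1) iff (6)\<close>
     (IYB_group G \<longleftrightarrow>
       (\<exists>(X :: 'e::infinite set) \<Lambda>.
          finite X \<and> IYB_map X \<Lambda> \<and>
          G \<cong> (BijGroup X)\<lparr>carrier := generate (BijGroup X) (\<Lambda> ` X)\<rparr>))
     \<and> \<comment> \<open>(1) iff (7)\<close>
     (IYB_group G \<longleftrightarrow>
       (\<exists>\<mu> \<in> hom G (BijGroup (carrier G)).
          \<forall>x\<in>carrier G. \<forall>y\<in>carrier G.
            x \<otimes> (inv\<^bsub>BijGroup (carrier G)\<^esub> (\<mu> x)) y =
            y \<otimes> (inv\<^bsub>BijGroup (carrier G)\<^esub> (\<mu> y)) x))
     \<and> \<comment> \<open>(1) iff (8)\<close>
     (IYB_group G \<longleftrightarrow>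
       (\<exists>Z \<mu>. Z \<subseteq> carrier G \<and> generate G Z = carrier G \<and>
          \<mu> \<in> hom G (BijGroup Z) \<and>
          (\<forall>x\<in>Z. \<forall>y\<in>Z.
            x \<otimes> (inv\<^bsub>BijGroup Z\<^esub> (\<mu> x)) y =
            y \<otimes> (inv\<^bsub>BijGroup Z\<^esub> (\<mu> y)) x)))"
proof -
  interpret group G by fact
  note fin = \<open>finite (carrier G)\<close>
  show ?thesis
    unfolding IYB_group_iff_exists_brace[OF fin]
    by (intro conjI exists_brace_iff_section exists_brace_iff_bijective_cocycle
        exists_brace_iff_IYB_map exists_brace_iff_permutation_action
        exists_brace_iff_generating_subset fin)
qed

end
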